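(* Let $H$ be a finite-dimensional unimodular Hopf algebra over a field $\Bbbk$, let $\Lambda$ be a left integral of $H$ and $\lambda$ a right integral of $H^*$ such that $\lambda(\Lambda)=1$. Let $J$ be a normalized twist of $H$, let $H^J$ be the twisted Hopf algebra, let $\{-,-\}^J$ denote the commutator in $H^J$, and let $\lambda^J$ be the right integral of $(H^J)^*$ given by $\lambda^J(a)=\lambda(S(Q_J^{-1})Q_J\,a)$ for $a \in H$. Then for every $a$ in the center $Z(H)$ of $H$: (1) $\{a,\Lambda\}^J=\{a,\Lambda\}$; (2) $\lambda^J(\{a,\Lambda\}^J)=\lambda(\{a,\Lambda\})$.
   Context: Sweedler notation: $\Delta(a)=a_1\otimes a_2$; $S$ is the antipode, $\varepsilon$ the counit. $H$ is unimodular if its left integrals (elements $\Lambda$ with $h\Lambda=\varepsilon(h)\Lambda$ for all $h$) are also right integrals. A right integral of $H^*$ is $\lambda\in H^*$ with $\lambda(a_1)a_2=\lambda(a)1$ for all $a\in H$. The distinguished group-like element $g\in H$ is determined by $a_1\lambda(a_2)=\lambda(a)g$ for all $a\in H$ (for $\lambda$ a nonzero right integral of $H^*$); for unimodular $H$ one has $S^4(a)=gag^{-1}$. Commutator: for a finite-dimensional unimodular Hopf algebra and elements $a,b$, $\{a,b\}:=a_1S^2(b_1)S(a_2)S^{-1}(b_2)g^{-1}$. A normalized twist for $H$ is an invertible $J=J^{(1)}\otimes J^{(2)}\in H\otimes H$ with $(\varepsilon\otimes\mathrm{id})(J)=(\mathrm{id}\otimes\varepsilon)(J)=1$ and $(\Delta\otimes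 \mathrm{id})(J)(J\otimes1)=(\mathrm{id}\otimes\Delta)(J)(1\otimes J)$. Write $J^{-1}=J^{-(1)}\otimes J^{-(2)}$. The Hopf algebra $H^J$ has the same algebra structure and counit as $H$, comultiplication $\Delta^J(a)=J^{-1}\Delta(a)J$ and antipode $S^J(a)=Q_J^{-1}S(a)Q_J$, where $Q_J=S(J^{(1)})J^{(2)}$, with inverse $Q_J^{-1}=J^{-(1)}S(J^{-(2)})$. $H^J$ is again unimodular with the same integral $\Lambda$ (and $\lambda^J(\Lambda)=1$). The commutator $\{a,b\}^J$ is the commutator defined by the formula above using the comultiplication, antipode and distinguished group-like element of $H^J$. *)

theory Defs
  imports Complex_Main "HOL-Library.Function_Algebras"
begin

section \<open>Tensor powers of a vector space\<close>

text \<open>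
  Over a field, an algebraic tensor product embeds into the dual of the space of multilinear
  forms on the factors: the pure tensor of a tuple is evaluation at that tuple.  A tensor is
  here a function from scalar-valued functions on tuples to scalars, equal to zero away from the
  multilinear forms (singled out by the predicate \<open>P\<close>), and the tensor product consists of the finite
  sums of pure tensors.  Addition of tensors is pointwise.  The lemmas \<open>tlift2_tens2_sum\<close>
  and \<open>tlift3_tens3_sum\<close> below give the universal property.
\<close>

type_synonym ('k, 'x) tensor = "('x \<Rightarrow> 'k) \<Rightarrow> 'k"

definition pure_tensor ::
    "(('x \<Rightarrow> 'k::field) \<Rightarrow> bool) \<Rightarrow> 'x \<Rightarrow> ('k, 'x) tensor" where
  "pure_tensor P x = (\<lambda>\<beta>. if P \<beta> then \<beta> x else 0)"

definition tensors :: "(('x \<Rightarrow> 'k::field) \<Rightarrow> bool) \<Rightarrow> ('k, 'x) tensor set" where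
  "tensors P = range (\<lambda>xs. \<Sum>x\<leftarrow>xs. pure_tensor P x)"

definition tscale :: "'k::field \<Rightarrow> ('k, 'x) tensor \<Rightarrow> ('k, 'x) tensor" where
  "tscale c t = (\<lambda>\<beta>. c * t \<beta>)"

text \<open>
  Value at \<open>t\<close> of the linear map induced by a multilinear map \<open>f\<close>: write \<open>t\<close> as a
  finite sum of pure tensors and sum \<open>f\<close> over it.  Sweedler notation is rendered by this.
\<close>

definition tlift ::
    "(('x \<Rightarrow> 'k::field) \<Rightarrow> bool) \<Rightarrow> ('x \<Rightarrow> 'v::comm_monoid_add) \<Rightarrow> ('k, 'x) tensor \<Rightarrow> 'v" where
  "tlift P f t = (\<Sum>x\<leftarrow>(SOME xs. t = (\<Sum>x\<leftarrow>xs. pure_tensor P x)). f x)"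

definition bilin ::
    "('k::field \<Rightarrow> 'a::ab_group_add \<Rightarrow> 'a) \<Rightarrow> ('k \<Rightarrow> 'v::ab_group_add \<Rightarrow> 'v)
      \<Rightarrow> ('a \<times> 'a \<Rightarrow> 'v) \<Rightarrow> bool" where
  "bilin s s' f \<longleftrightarrow>
     (\<forall>y. Vector_Spaces.linear s s' (\<lambda>x. f (x, y))) \<and>
     (\<forall>x. Vector_Spaces.linear s s' (\<lambda>y. f (x, y)))"

definition trilin ::
    "('k::field \<Rightarrow> 'a::ab_group_add \<Rightarrow> 'a) \<Rightarrow> ('k \<Rightarrow> 'v::ab_group_add \<Rightarrow> 'v)
      \<Rightarrow> ('a \<times> 'a \<times> 'a \<Rightarrow> 'v) \<Rightarrow> bool" where
  "trilin s s' f \<longleftrightarrow>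
     (\<forall>y z. Vector_Spaces.linear s s' (\<lambda>x. f (x, y, z))) \<and>
     (\<forall>x z. Vector_Spaces.linear s s' (\<lambda>y. f (x, y, z))) \<and>
     (\<forall>x y. Vector_Spaces.linear s s' (\<lambda>z. f (x, y, z)))"

lemma vector_space_field: "vector_space ((*) :: 'k::field \<Rightarrow> 'k \<Rightarrow> 'k)"
  by unfold_locales (auto simp: algebra_simps)

lemma vector_space_tscale: "vector_space (tscale :: 'k::field \<Rightarrow> ('k, 'x) tensor \<Rightarrow> _)"
  by unfold_locales (auto simp: tscale_def algebra_simps)

lemma linear_form_separates:
  fixes s :: "'k::field \<Rightarrow> 'v::ab_group_add \<Rightarrow> 'v"
  assumes "vector_space s" and "v \<noteq> 0"
  obtains \<phi> where "Vector_Spaces.linear s ((*) :: 'k \<Rightarrow> 'k \<Rightarrow> 'k) \<phi>" and "\<phi> v \<noteq> 0"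
proof -
  interpret V: vector_space s by fact
  interpret K: vector_space "(*) :: 'k \<Rightarrow> 'k \<Rightarrow> 'k" by (rule vector_space_field)
  interpret vector_space_pair s "(*) :: 'k \<Rightarrow> 'k \<Rightarrow> 'k" ..
  have "V.independent {v}" using assms(2) by simp
  from linear_independent_extend[OF this, of "\<lambda>_. 1"]
  obtain \<phi> where "Vector_Spaces.linear s (*) \<phi>" "\<phi> v = 1" by auto
  then show thesis by (intro that) auto
qed

lemma linear_sum_list:
  assumes "Vector_Spaces.linear s s' g"
  shows "g (\<Sum>x\<leftarrow>xs. f x) = (\<Sum>x\<leftarrow>xs. g (f x))"
proof -
  interpret g: Vector_Spaces.linear s s' g by fact
  show ?thesis by (induction xs) (auto simp: g.add)
qed

lemma sum_list_fun_apply: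
  fixes f :: "'x \<Rightarrow> 'b \<Rightarrow> 'c::comm_monoid_add"
  shows "(\<Sum>x\<leftarrow>xs. f x) \<beta> = (\<Sum>x\<leftarrow>xs. f x \<beta>)"
  by (induction xs) auto

lemma tlift_sum:
  fixes s :: "'k::field \<Rightarrow> 'v::ab_group_add \<Rightarrow> 'v"
  assumes "vector_space s"
    and P: "\<And>\<phi>. Vector_Spaces.linear s ((*) :: 'k \<Rightarrow> 'k \<Rightarrow> 'k) \<phi> \<Longrightarrow> P (\<lambda>x. \<phi> (f x))"
  shows "tlift P f (\<Sum>x\<leftarrow>xs. pure_tensor P x) = (\<Sum>x\<leftarrow>xs. f x)"
proof -
  define ys where "ys = (SOME ys. (\<Sum>x\<leftarrow>xs. pure_tensor P x) = (\<Sum>x\<leftarrow>ys. pure_tensor P x))"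
  have eq: "(\<Sum>x\<leftarrow>xs. pure_tensor P x) = (\<Sum>x\<leftarrow>ys. pure_tensor P x)"
    unfolding ys_def by (rule someI) (rule refl)
  have "(\<Sum>x\<leftarrow>ys. f x) - (\<Sum>x\<leftarrow>xs. f x) = 0"
  proof (rule ccontr)
    assume "(\<Sum>x\<leftarrow>ys. f x) - (\<Sum>x\<leftarrow>xs. f x) \<noteq> 0"
    then obtain \<phi> where lin: "Vector_Spaces.linear s ((*) :: 'k \<Rightarrow> 'k \<Rightarrow> 'k) \<phi>"
      and ne: "\<phi> ((\<Sum>x\<leftarrow>ys. f x) - (\<Sum>x\<leftarrow>xs. f x)) \<noteq> 0"
      using linear_form_separates[OF assms(1)] by blast
    interpret \<phi>: Vector_Spaces.linear s "(*)" \<phi> by (rule lin)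
    have sums: "(\<Sum>x\<leftarrow>zs. pure_tensor P x) (\<lambda>x. \<phi> (f x)) = \<phi> (\<Sum>x\<leftarrow>zs. f x)" for zs
      using P[OF lin] by (simp add: sum_list_fun_apply pure_tensor_def linear_sum_list[OF lin])
    from ne sums[of xs] sums[of ys] eq show False by (simp add: \<phi>.diff)
  qed
  then show ?thesis by (simp add: tlift_def ys_def)
qed

lemma linear_compose_form:
  assumes "Vector_Spaces.linear s s' g" "Vector_Spaces.linear s' s'' h"
  shows "Vector_Spaces.linear s s'' (\<lambda>x. h (g x))"
  using Vector_Spaces.linear_compose[OF assms] by (simp add: comp_def)

section \<open>Hopf algebras\<close>

text \<open>
  The underlying ring is the type \<open>'a\<close>; the record carries the remaining data.  In
  particular a twist of \<open>H\<close> has the same algebra structure by construction.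
\<close>

record ('k, 'a) hopf =
  smult :: "'k \<Rightarrow> 'a \<Rightarrow> 'a"
  comult :: "'a \<Rightarrow> ('k, 'a \<times> 'a) tensor"
  counit :: "'a \<Rightarrow> 'k"
  antipode :: "'a \<Rightarrow> 'a"

definition tens2 :: "('k::field, 'a::ring_1) hopf \<Rightarrow> 'a \<Rightarrow> 'a \<Rightarrow> ('k, 'a \<times> 'a) tensor" where
  "tens2 H x y = pure_tensor (bilin (smult H) (*)) (x, y)"

definition tens3 ::
    "('k::field, 'a::ring_1) hopf \<Rightarrow> 'a \<Rightarrow> 'a \<Rightarrow> 'a \<Rightarrow> ('k, 'a \<times> 'a \<times> 'a) tensor" where
  "tens3 H x y z = pure_tensor (trilin (smult H) (*)) (x, y, z)"

definition tensors2 :: "('k::field, 'a::ring_1) hopf \<Rightarrow> ('k, 'a \<times> 'a) tensor set" where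
  "tensors2 H = tensors (bilin (smult H) (*))"

definition tlift2 ::
    "('k::field, 'a::ring_1) hopf \<Rightarrow> ('a \<Rightarrow> 'a \<Rightarrow> 'v::comm_monoid_add)
      \<Rightarrow> ('k, 'a \<times> 'a) tensor \<Rightarrow> 'v" where
  "tlift2 H f t = tlift (bilin (smult H) (*)) (\<lambda>(x, y). f x y) t"

definition tlift3 ::
    "('k::field, 'a::ring_1) hopf \<Rightarrow> ('a \<Rightarrow> 'a \<Rightarrow> 'a \<Rightarrow> 'v::comm_monoid_add)
      \<Rightarrow> ('k, 'a \<times> 'a \<times> 'a) tensor \<Rightarrow> 'v" where
  "tlift3 H f t = tlift (trilin (smult H) (*)) (\<lambda>(x, y, z). f x y z) t"

lemma tlift2_tens2_sum:
  fixes s :: "'k::field \<Rightarrow> 'v::ab_group_add \<Rightarrow> 'v"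
  assumes "bilin (smult H) s (\<lambda>(x, y). f x y)"
  shows "tlift2 H f (\<Sum>(x, y)\<leftarrow>xs. tens2 H x y) = (\<Sum>(x, y)\<leftarrow>xs. f x y)"
proof -
  have "vector_space s"
    using assms unfolding bilin_def Vector_Spaces.linear_def by blast
  then have "tlift (bilin (smult H) (*)) (\<lambda>(x, y). f x y)
      (\<Sum>x\<leftarrow>xs. pure_tensor (bilin (smult H) (*)) x) = (\<Sum>(x, y)\<leftarrow>xs. f x y)"
    by (rule tlift_sum) (use assms in \<open>auto simp: bilin_def intro: linear_compose_form\<close>)
  then show ?thesis by (simp add: tlift2_def tens2_def case_prod_unfold)
qed

lemma tlift3_tens3_sum:
  fixes s :: "'k::field \<Rightarrow> 'v::ab_group_add \<Rightarrow> 'v"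
  assumes "trilin (smult H) s (\<lambda>(x, y, z). f x y z)"
  shows "tlift3 H f (\<Sum>(x, y, z)\<leftarrow>xs. tens3 H x y z) = (\<Sum>(x, y, z)\<leftarrow>xs. f x y z)"
proof -
  have "vector_space s"
    using assms unfolding trilin_def Vector_Spaces.linear_def by blast
  then have "tlift (trilin (smult H) (*)) (\<lambda>(x, y, z). f x y z)
      (\<Sum>x\<leftarrow>xs. pure_tensor (trilin (smult H) (*)) x) = (\<Sum>(x, y, z)\<leftarrow>xs. f x y z)"
    by (rule tlift_sum) (use assms in \<open>auto simp: trilin_def elim!: linear_compose_form[rotated]\<close>)
  then show ?thesis by (simp add: tlift3_def tens3_def case_prod_unfold)
qed

definition tmult2 ::
    "('k::field, 'a::ring_1) hopf \<Rightarrow> ('k, 'a \<times> 'a) tensor \<Rightarrow> ('k, 'a \<times> 'a) tensor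
      \<Rightarrow> ('k, 'a \<times> 'a) tensor" where
  "tmult2 H t u =
     tlift2 H (\<lambda>a b. tlift2 H (\<lambda>c d. tens2 H (a * c) (b * d)) u) t"

definition tmult3 ::
    "('k::field, 'a::ring_1) hopf \<Rightarrow> ('k, 'a \<times> 'a \<times> 'a) tensor \<Rightarrow> ('k, 'a \<times> 'a \<times> 'a) tensor
      \<Rightarrow> ('k, 'a \<times> 'a \<times> 'a) tensor" where
  "tmult3 H t u =
     tlift3 H (\<lambda>a b c. tlift3 H (\<lambda>d e f. tens3 H (a * d) (b * e) (c * f)) u) t"

definition comult_id ::
    "('k::field, 'a::ring_1) hopf \<Rightarrow> ('k, 'a \<times> 'a) tensor \<Rightarrow> ('k, 'a \<times> 'a \<times> 'a) tensor" where
  "comult_id H t = tlift2 H (\<lambda>x y. tlift2 H (\<lambda>x1 x2. tens3 H x1 x2 y) (comult H x)) t"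

definition id_comult ::
    "('k::field, 'a::ring_1) hopf \<Rightarrow> ('k, 'a \<times> 'a) tensor \<Rightarrow> ('k, 'a \<times> 'a \<times> 'a) tensor" where
  "id_comult H t = tlift2 H (\<lambda>x y. tlift2 H (\<lambda>y1 y2. tens3 H x y1 y2) (comult H y)) t"

definition counit_id :: "('k::field, 'a::ring_1) hopf \<Rightarrow> ('k, 'a \<times> 'a) tensor \<Rightarrow> 'a" where
  "counit_id H t = tlift2 H (\<lambda>x y. smult H (counit H x) y) t"

definition id_counit :: "('k::field, 'a::ring_1) hopf \<Rightarrow> ('k, 'a \<times> 'a) tensor \<Rightarrow> 'a" where
  "id_counit H t = tlift2 H (\<lambda>x y. smult H (counit H y) x) t"

locale hopf_algebra =
  fixes H :: "('k::field, 'a::ring_1) hopf"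
  assumes vector_space_smult: "vector_space (smult H)"
    and smult_mult_left: "smult H c x * y = smult H c (x * y)"
    and smult_mult_right: "x * smult H c y = smult H c (x * y)"
    and comult_tensors2: "comult H x \<in> tensors2 H"
    and comult_linear: "Vector_Spaces.linear (smult H) tscale (comult H)"
    and comult_mult: "comult H (x * y) = tmult2 H (comult H x) (comult H y)"
    and comult_one: "comult H 1 = tens2 H 1 1"
    and counit_linear: "Vector_Spaces.linear (smult H) (*) (counit H)"
    and counit_mult: "counit H (x * y) = counit H x * counit H y"
    and counit_one: "counit H 1 = 1"
    and coassoc: "comult_id H (comult H x) = id_comult H (comult H x)"
    and counit_left: "counit_id H (comult H x) = x"
    and counit_right: "id_counit H (comult H x) = x"
    and antipode_linear: "Vector_Spaces.linear (smult H) (smult H) (antipode H)"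
    and antipode_left:
      "tlift2 H (\<lambda>x1 x2. antipode H x1 * x2) (comult H x) = smult H (counit H x) 1"
    and antipode_right:
      "tlift2 H (\<lambda>x1 x2. x1 * antipode H x2) (comult H x) = smult H (counit H x) 1"

definition finite_dim :: "('k::field, 'a::ring_1) hopf \<Rightarrow> bool" where
  "finite_dim H \<longleftrightarrow> (\<exists>B. finite_dimensional_vector_space (smult H) B)"

section \<open>Integrals, the distinguished group-like element, and the commutator\<close>

definition left_integral :: "('k::field, 'a::ring_1) hopf \<Rightarrow> 'a \<Rightarrow> bool" where
  "left_integral H \<Lambda> \<longleftrightarrow> (\<forall>h. h * \<Lambda> = smult H (counit H h) \<Lambda>)"

definition right_integral :: "('k::field, 'a::ring_1) hopf \<Rightarrow> 'a \<Rightarrow> bool" where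
  "right_integral H \<Lambda> \<longleftrightarrow> (\<forall>h. \<Lambda> * h = smult H (counit H h) \<Lambda>)"

definition unimodular :: "('k::field, 'a::ring_1) hopf \<Rightarrow> bool" where
  "unimodular H \<longleftrightarrow> (\<forall>\<Lambda>. left_integral H \<Lambda> \<longrightarrow> right_integral H \<Lambda>)"

definition dual_right_integral :: "('k::field, 'a::ring_1) hopf \<Rightarrow> ('a \<Rightarrow> 'k) \<Rightarrow> bool" where
  "dual_right_integral H l \<longleftrightarrow>
     Vector_Spaces.linear (smult H) (*) l \<and>
     (\<forall>a. tlift2 H (\<lambda>a1 a2. smult H (l a1) a2) (comult H a) = smult H (l a) 1)"

definition distinguished_grouplike :: "('k::field, 'a::ring_1) hopf \<Rightarrow> 'a" where
  "distinguished_grouplike H =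
     (THE g. \<exists>l. dual_right_integral H l \<and> l \<noteq> (\<lambda>_. 0) \<and>
        (\<forall>a. tlift2 H (\<lambda>a1 a2. smult H (l a2) a1) (comult H a) = smult H (l a) g))"

definition ring_inverse :: "'a::ring_1 \<Rightarrow> 'a" where
  "ring_inverse x = (THE y. x * y = 1 \<and> y * x = 1)"

definition commutator :: "('k::field, 'a::ring_1) hopf \<Rightarrow> 'a \<Rightarrow> 'a \<Rightarrow> 'a" where
  "commutator H a b =
     tlift2 H (\<lambda>a1 a2. tlift2 H (\<lambda>b1 b2.
        a1 * antipode H (antipode H b1) * antipode H a2 * inv (antipode H) b2
          * ring_inverse (distinguished_grouplike H)) (comult H b)) (comult H a)"

section \<open>Twists\<close>

definition is_tinverse2 ::
    "('k::field, 'a::ring_1) hopf \<Rightarrow> ('k, 'a \<times> 'a) tensor \<Rightarrow> ('k, 'a \<times> 'a) tensor \<Rightarrow> bool" where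
  "is_tinverse2 H J K \<longleftrightarrow>
     K \<in> tensors2 H \<and> tmult2 H J K = tens2 H 1 1 \<and> tmult2 H K J = tens2 H 1 1"

definition tinverse2 ::
    "('k::field, 'a::ring_1) hopf \<Rightarrow> ('k, 'a \<times> 'a) tensor \<Rightarrow> ('k, 'a \<times> 'a) tensor" where
  "tinverse2 H J = (THE K. is_tinverse2 H J K)"

definition normalized_twist ::
    "('k::field, 'a::ring_1) hopf \<Rightarrow> ('k, 'a \<times> 'a) tensor \<Rightarrow> bool" where
  "normalized_twist H J \<longleftrightarrow>
     J \<in> tensors2 H \<and> (\<exists>K. is_tinverse2 H J K) \<and>
     counit_id H J = 1 \<and> id_counit H J = 1 \<and>
     tmult3 H (comult_id H J) (tlift2 H (\<lambda>x y. tens3 H x y 1) J) =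
     tmult3 H (id_comult H J) (tlift2 H (\<lambda>x y. tens3 H 1 x y) J)"

definition twist_Q :: "('k::field, 'a::ring_1) hopf \<Rightarrow> ('k, 'a \<times> 'a) tensor \<Rightarrow> 'a" where
  "twist_Q H J = tlift2 H (\<lambda>x y. antipode H x * y) J"

definition twisted ::
    "('k::field, 'a::ring_1) hopf \<Rightarrow> ('k, 'a \<times> 'a) tensor \<Rightarrow> ('k, 'a) hopf" where
  "twisted H J = H\<lparr>
     comult := (\<lambda>a. tmult2 H (tmult2 H (tinverse2 H J) (comult H a)) J),
     antipode := (\<lambda>a. ring_inverse (twist_Q H J) * antipode H a * twist_Q H J)\<rparr>"

definition twisted_dual_integral ::
    "('k::field, 'a::ring_1) hopf \<Rightarrow> ('k, 'a \<times> 'a) tensor \<Rightarrow> ('a \<Rightarrow> 'k) \<Rightarrow> 'a \<Rightarrow> 'k" where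
  "twisted_dual_integral H J l a =
     l (antipode H (ring_inverse (twist_Q H J)) * twist_Q H J * a)"

end

theory Submission
  imports Defs
begin

text \<open>
  Write \<Delta>(\<Lambda>) = \<Lambda>1 \<otimes> \<Lambda>2, let S' be the inverse of the antipode, K the inverse of J, and
  F(y) = S^2(\<Lambda>1) y S'(\<Lambda>2) g^-1.  Since H is unimodular, \<Lambda> is a two-sided integral, and so
  \<Lambda>1 \<otimes> h \<Lambda>2 = S(h) \<Lambda>1 \<otimes> \<Lambda>2 and \<Lambda>1 \<otimes> \<Lambda>2 S(h) = \<Lambda>1 h \<otimes> \<Lambda>2 for all h
  (\<open>left_integral_shift\<close>, \<open>right_integral_shift\<close>).  These two rules give F(yz) = F(S^2(z) y), and
  with Radford's formula S^4(h) g = g h they make every value of F central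
  (\<open>central_trace_cyclic\<close>, \<open>central_trace_central\<close>).  In terms of F the commutator is
  {a, \<Lambda>} = a1 F(S(a2)).

  The same rules show that the coproduct of \<Lambda> in H^J is Q^-1 \<Lambda>1 \<otimes> \<Lambda>2 Q (\<open>sw_T_Lambda\<close>).  The
  integral and the distinguished group-like element of a Hopf algebra can be read off from the
  coproduct of \<Lambda> (locale \<open>frobenius_coalgebra\<close>), which gives
  g_J = Q^-1 S(Q) S^2(Q^-1) S^3(Q) g (\<open>distinguished_T\<close>).  Substituting all this into the definition
  of the commutator of H^J, the centrality and cyclicity of F absorb every conjugating factor except
  one, and what remains is b1 F(S(b2 Q^-1 S(Q))) with b1 \<otimes> b2 = K \<Delta>(a) J
  (\<open>commutator_T_eq_central_trace\<close>).

  Here centrality of a enters.  As \<Delta>(a) commutes with the coproducts of H, the first leg of K can be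
  carried past \<Delta>(a), at the price of two further coproduct factors (\<open>central_slide\<close>); the second leg
  is carried around by the cyclicity of F.  All of K and J is then collected in one tensor on the
  right of \<Delta>(a), which the twist equation evaluates to 1 \<otimes> 1: its consequence
  J (1 \<otimes> Q^-1) = \<Delta>(K1) (1 \<otimes> S(K2)) is used twice (\<open>J_Qi\<close>, \<open>twist_slide\<close>).  This proves
  {a, \<Lambda>}^J = {a, \<Lambda>}.

  For the second claim, {a, \<Lambda>} is central, again by \<open>central_slide\<close>; and for central z
  the rule \<lambda>(xy) = \<lambda>(S^2(y) x) turns \<lambda>(S(Q^-1) Q z) into \<lambda>(S(J1 K1) J2 K2 z) = \<lambda>(z).

  Identities between tensors are proved in a weak form: two tensors agree if all multilinear
  maps take the same value on them.  A Sweedler expression is therefore a nested sum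
  \<open>tlift2 H f t\<close> with f bilinear, and an identity in the third tensor power is an equation between
  operators on trilinear maps.
\<close>

section \<open>Multilinear maps on tensors\<close>

abbreviation lin ::
    "('k::field, 'a::ring_1) hopf \<Rightarrow> ('k \<Rightarrow> 'v::ab_group_add \<Rightarrow> 'v) \<Rightarrow> ('a \<Rightarrow> 'v) \<Rightarrow> bool" where
  "lin H \<equiv> Vector_Spaces.linear (smult H)"

definition bil ::
    "('k::field, 'a::ring_1) hopf \<Rightarrow> ('k \<Rightarrow> 'v::ab_group_add \<Rightarrow> 'v) \<Rightarrow> ('a \<Rightarrow> 'a \<Rightarrow> 'v) \<Rightarrow> bool" where
  "bil H s f \<longleftrightarrow> (\<forall>y. lin H s (\<lambda>x. f x y)) \<and> (\<forall>x. lin H s (\<lambda>y. f x y))"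

definition tril ::
    "('k::field, 'a::ring_1) hopf \<Rightarrow> ('k \<Rightarrow> 'v::ab_group_add \<Rightarrow> 'v) \<Rightarrow> ('a \<Rightarrow> 'a \<Rightarrow> 'a \<Rightarrow> 'v) \<Rightarrow> bool" where
  "tril H s f \<longleftrightarrow> (\<forall>y z. lin H s (\<lambda>x. f x y z)) \<and> (\<forall>x z. lin H s (\<lambda>y. f x y z))
     \<and> (\<forall>x y. lin H s (\<lambda>z. f x y z))"

lemma linear_codomain: "Vector_Spaces.linear s s' f \<Longrightarrow> vector_space s'"
  by (simp add: Vector_Spaces.linear_def)

lemma linear_domain: "Vector_Spaces.linear s s' f \<Longrightarrow> vector_space s"
  by (simp add: Vector_Spaces.linear_def)

lemma linear_sum_list_pointwise:
  assumes "vector_space s" "vector_space s'" "\<And>y. Vector_Spaces.linear s s' (\<lambda>x. f x y)"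
  shows "Vector_Spaces.linear s s' (\<lambda>x. \<Sum>y\<leftarrow>ys. f x y)"
proof -
  interpret A: vector_space s by fact
  interpret B: vector_space s' by fact
  interpret vector_space_pair s s' ..
  show ?thesis
  proof (induction ys)
    case Nil
    then show ?case by (simp add: linear_zero)
  next
    case (Cons y ys)
    then show ?case using linear_compose_add[OF assms(3)] by simp
  qed
qed

lemma (in vector_space) linear_forms_separate:
  assumes "\<And>\<phi>. Vector_Spaces.linear scale (*) \<phi> \<Longrightarrow> \<phi> v = \<phi> w"
  shows "v = w"
proof (rule ccontr)
  assume "v \<noteq> w"
  then obtain \<phi> where p: "Vector_Spaces.linear scale (*) \<phi>" "\<phi> (v - w) \<noteq> 0"
    using linear_form_separates[OF vector_space_axioms, of "v - w"] by auto
  interpret p: Vector_Spaces.linear scale "(*)" \<phi> by (rule p)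
  show False using assms[OF p(1)] p(2) by (simp add: p.diff)
qed

lemma pure_tensor_in_tensors: "pure_tensor P x \<in> tensors P"
  unfolding tensors_def by (rule image_eqI[of _ _ "[x]"]) auto

lemma tensors_sum_list:
  assumes "\<And>y. T y \<in> tensors P"
  shows "(\<Sum>y\<leftarrow>ys. T y) \<in> tensors P"
proof -
  have "\<forall>y. \<exists>xs. T y = (\<Sum>x\<leftarrow>xs. pure_tensor P x)"
    using assms unfolding tensors_def by blast
  then obtain r where r: "\<And>y. T y = (\<Sum>x\<leftarrow>r y. pure_tensor P x)"
    unfolding choice_iff by blast
  have "(\<Sum>y\<leftarrow>ys. T y) = (\<Sum>x\<leftarrow>concat (map r ys). pure_tensor P x)"
    by (induction ys) (auto simp: r)
  then show ?thesis unfolding tensors_def by auto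
qed

lemma tlift_sum_list:
  fixes s :: "'k::field \<Rightarrow> 'v::ab_group_add \<Rightarrow> 'v"
  assumes vs: "vector_space s"
    and P: "\<And>\<phi>. Vector_Spaces.linear s ((*) :: 'k \<Rightarrow> 'k \<Rightarrow> 'k) \<phi> \<Longrightarrow> P (\<lambda>x. \<phi> (f x))"
    and T: "\<And>y. T y \<in> tensors P"
  shows "tlift P f (\<Sum>y\<leftarrow>ys. T y) = (\<Sum>y\<leftarrow>ys. tlift P f (T y))"
proof -
  have "\<forall>y. \<exists>xs. T y = (\<Sum>x\<leftarrow>xs. pure_tensor P x)"
    using T unfolding tensors_def by blast
  then obtain r where r: "\<And>y. T y = (\<Sum>x\<leftarrow>r y. pure_tensor P x)"
    unfolding choice_iff by blast
  have "(\<Sum>y\<leftarrow>ys. T y) = (\<Sum>x\<leftarrow>concat (map r ys). pure_tensor P x)"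
    by (induction ys) (auto simp: r)
  then have "tlift P f (\<Sum>y\<leftarrow>ys. T y) = (\<Sum>x\<leftarrow>concat (map r ys). f x)"
    by (simp add: tlift_sum[OF vs P])
  also have "\<dots> = (\<Sum>y\<leftarrow>ys. \<Sum>x\<leftarrow>r y. f x)"
    by (induction ys) auto
  also have "\<dots> = (\<Sum>y\<leftarrow>ys. tlift P f (T y))"
    by (simp add: r tlift_sum[OF vs P])
  finally show ?thesis .
qed

text \<open>
  Linearity of the induced map cannot be read off from its definition, which picks a representation
  of every tensor separately.  But a linear form \<phi> after the induced map is evaluation of the tensor
  at the form \<phi> after f, and evaluation is linear.
\<close>

lemma tlift_linear:
  fixes s :: "'k::field \<Rightarrow> 'v::ab_group_add \<Rightarrow> 'v"
  assumes vs: "vector_space s"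
    and P: "\<And>\<phi>. Vector_Spaces.linear s ((*) :: 'k \<Rightarrow> 'k \<Rightarrow> 'k) \<phi> \<Longrightarrow> P (\<lambda>x. \<phi> (f x))"
    and T: "\<And>x. T x \<in> tensors P" and lin: "Vector_Spaces.linear r tscale T"
  shows "Vector_Spaces.linear r s (\<lambda>x. tlift P f (T x))"
proof -
  interpret S: vector_space s by fact
  interpret R: vector_space r using linear_domain[OF lin] .
  interpret T: Vector_Spaces.linear r tscale T by fact
  interpret vector_space_pair r s ..
  have eq: "\<phi> (tlift P f t) = t (\<lambda>x. \<phi> (f x))"
    if "t \<in> tensors P" "Vector_Spaces.linear s (*) \<phi>" for t \<phi>
  proof -
    obtain xs where t: "t = (\<Sum>x\<leftarrow>xs. pure_tensor P x)"
      using \<open>t \<in> tensors P\<close> unfolding tensors_def by auto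
    have "tlift P f t = (\<Sum>x\<leftarrow>xs. f x)" unfolding t by (rule tlift_sum[OF vs P])
    then show ?thesis
      using P[OF that(2)]
      by (simp add: t sum_list_fun_apply pure_tensor_def linear_sum_list[OF that(2)])
  qed
  show ?thesis
  proof (unfold Vector_Spaces.linear_iff, intro conjI allI)
    show "vector_space r" by (rule linear_domain[OF lin])
  next
    show "vector_space s" by (rule vs)
  next
    fix x y
    show "tlift P f (T (x + y)) = tlift P f (T x) + tlift P f (T y)"
    proof (rule S.linear_forms_separate)
      fix \<phi> :: "'v \<Rightarrow> 'k" assume p: "Vector_Spaces.linear s (*) \<phi>"
      interpret p: Vector_Spaces.linear s "(*)" \<phi> by (rule p)
      show "\<phi> (tlift P f (T (x + y))) = \<phi> (tlift P f (T x) + tlift P f (T y))"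
        by (simp add: p.add eq[OF T p], simp add: T.add)
    qed
    fix c x
    show "tlift P f (T (r c x)) = s c (tlift P f (T x))"
    proof (rule S.linear_forms_separate)
      fix \<phi> :: "'v \<Rightarrow> 'k" assume p: "Vector_Spaces.linear s (*) \<phi>"
      interpret p: Vector_Spaces.linear s "(*)" \<phi> by (rule p)
      show "\<phi> (tlift P f (T (r c x))) = \<phi> (s c (tlift P f (T x)))"
        by (simp add: p.scale eq[OF T p], simp add: T.scale tscale_def)
    qed
  qed
qed

lemma bil_bilin: "bil H s f \<longleftrightarrow> bilin (smult H) s (\<lambda>(x, y). f x y)"
  by (auto simp: bil_def bilin_def)

lemma tril_trilin: "tril H s f \<longleftrightarrow> trilin (smult H) s (\<lambda>(x, y, z). f x y z)"
  by (auto simp: tril_def trilin_def)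

lemma bil_form:
  "bil H s f \<Longrightarrow> Vector_Spaces.linear s (*) \<phi> \<Longrightarrow>
    bilin (smult H) (*) (\<lambda>x. \<phi> (case x of (x, y) \<Rightarrow> f x y))"
  by (auto simp: bil_def bilin_def intro: linear_compose_form)

lemma tril_form:
  "tril H s f \<Longrightarrow> Vector_Spaces.linear s (*) \<phi> \<Longrightarrow>
    trilin (smult H) (*) (\<lambda>x. \<phi> (case x of (x, y, z) \<Rightarrow> f x y z))"
  by (auto simp: tril_def trilin_def elim!: linear_compose_form[rotated])

lemma bil_codomain: "bil H s f \<Longrightarrow> vector_space s"
  unfolding bil_def using linear_codomain by blast

lemma tril_codomain: "tril H s f \<Longrightarrow> vector_space s"
  unfolding tril_def using linear_codomain by blast

definition tensors3 :: "('k::field, 'a::ring_1) hopf \<Rightarrow> ('k, 'a \<times> 'a \<times> 'a) tensor set" where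
  "tensors3 H = tensors (trilin (smult H) (*))"

lemma tlift2_in_tensors2:
  "(\<And>x y. T x y \<in> tensors2 H) \<Longrightarrow> tlift2 H T t \<in> tensors2 H"
  unfolding tlift2_def tlift_def tensors2_def by (rule tensors_sum_list) (auto split: prod.split)

lemma tlift2_in_tensors3:
  "(\<And>x y. T x y \<in> tensors3 H) \<Longrightarrow> tlift2 H T t \<in> tensors3 H"
  unfolding tlift2_def tlift_def tensors3_def by (rule tensors_sum_list) (auto split: prod.split)

lemma tlift3_in_tensors3:
  "(\<And>x y z. T x y z \<in> tensors3 H) \<Longrightarrow> tlift3 H T t \<in> tensors3 H"
  unfolding tlift3_def tlift_def tensors3_def by (rule tensors_sum_list) (auto split: prod.split)

lemma tens2_in [simp]: "tens2 H x y \<in> tensors2 H"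
  unfolding tens2_def tensors2_def by (rule pure_tensor_in_tensors)

lemma tens3_in [simp]: "tens3 H x y z \<in> tensors3 H"
  unfolding tens3_def tensors3_def by (rule pure_tensor_in_tensors)

lemma tlift2_tens2: "bil H s f \<Longrightarrow> tlift2 H f (tens2 H x y) = f x y"
  using tlift2_tens2_sum[of H s f "[(x, y)]"] by (simp add: bil_bilin)

lemma tlift3_tens3: "tril H s f \<Longrightarrow> tlift3 H f (tens3 H x y z) = f x y z"
  using tlift3_tens3_sum[of H s f "[(x, y, z)]"] by (simp add: tril_trilin)

text \<open>
  Nested lifts, such as the two coproducts in coassociativity, are flattened to nested sums.
\<close>

lemma tlift2_tlift2:
  assumes f: "bil H s f" and T: "\<And>x y. T x y \<in> tensors2 H"
  shows "tlift2 H f (tlift2 H T t) = tlift2 H (\<lambda>x y. tlift2 H f (T x y)) t"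
proof -
  have "tlift2 H f (\<Sum>z\<leftarrow>zs. case z of (x, y) \<Rightarrow> T x y)
      = (\<Sum>z\<leftarrow>zs. tlift2 H f (case z of (x, y) \<Rightarrow> T x y))" for zs
    unfolding tlift2_def
    by (rule tlift_sum_list[OF bil_codomain[OF f]])
       (use T in \<open>auto simp: tensors2_def intro: bil_form[OF f] split: prod.split\<close>)
  then show ?thesis
    unfolding tlift2_def[of H T] tlift2_def[of H "\<lambda>x y. tlift2 H f (T x y)"]
      tlift_def[of _ "\<lambda>(x, y). T x y"]
      tlift_def[of _ "\<lambda>(x, y). tlift2 H f (T x y)"]
    by (simp add: case_prod_unfold)
qed

lemma tlift3_tlift2:
  assumes f: "tril H s f" and T: "\<And>x y. T x y \<in> tensors3 H"
  shows "tlift3 H f (tlift2 H T t) = tlift2 H (\<lambda>x y. tlift3 H f (T x y)) t"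
proof -
  have "tlift3 H f (\<Sum>z\<leftarrow>zs. case z of (x, y) \<Rightarrow> T x y)
      = (\<Sum>z\<leftarrow>zs. tlift3 H f (case z of (x, y) \<Rightarrow> T x y))" for zs
    unfolding tlift3_def
    by (rule tlift_sum_list[OF tril_codomain[OF f]])
       (use T in \<open>auto simp: tensors3_def intro: tril_form[OF f] split: prod.split\<close>)
  then show ?thesis
    unfolding tlift2_def[of H T] tlift2_def[of H "\<lambda>x y. tlift3 H f (T x y)"]
      tlift_def[of _ "\<lambda>(x, y). T x y"]
      tlift_def[of _ "\<lambda>(x, y). tlift3 H f (T x y)"]
    by (simp add: case_prod_unfold)
qed

lemma tlift3_tlift3:
  assumes f: "tril H s f" and T: "\<And>x y z. T x y z \<in> tensors3 H"
  shows "tlift3 H f (tlift3 H T t) = tlift3 H (\<lambda>x y z. tlift3 H f (T x y z)) t"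
proof -
  have "tlift3 H f (\<Sum>z\<leftarrow>zs. case z of (x, y, z) \<Rightarrow> T x y z)
      = (\<Sum>z\<leftarrow>zs. tlift3 H f (case z of (x, y, z) \<Rightarrow> T x y z))" for zs
    unfolding tlift3_def
    by (rule tlift_sum_list[OF tril_codomain[OF f]])
       (use T in \<open>auto simp: tensors3_def intro: tril_form[OF f] split: prod.split\<close>)
  then show ?thesis
    unfolding tlift3_def[of H T] tlift3_def[of H "\<lambda>x y z. tlift3 H f (T x y z)"]
      tlift_def[of _ "\<lambda>(x, y, z). T x y z"]
      tlift_def[of _ "\<lambda>(x, y, z). tlift3 H f (T x y z)"]
    by (simp add: case_prod_unfold)
qed

lemma sum_list_swap:
  fixes F :: "'u \<Rightarrow> 'w \<Rightarrow> 'x::comm_monoid_add"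
  shows "(\<Sum>x\<leftarrow>xs. \<Sum>y\<leftarrow>ys. F x y) = (\<Sum>y\<leftarrow>ys. \<Sum>x\<leftarrow>xs. F x y)"
  by (induction xs) (auto simp: sum_list_addf)

lemma tlift2_commute:
  "tlift2 H (\<lambda>x y. tlift2 H' (\<lambda>z w. f x y z w) u) t = tlift2 H' (\<lambda>z w. tlift2 H (\<lambda>x y. f x y z w) t) u"
  unfolding tlift2_def tlift_def case_prod_unfold by (rule sum_list_swap)

lemma linear_tlift2:
  "Vector_Spaces.linear s s' g \<Longrightarrow> g (tlift2 H f t) = tlift2 H (\<lambda>x y. g (f x y)) t"
  unfolding tlift2_def tlift_def by (simp add: linear_sum_list case_prod_unfold)

lemma scale_tlift2:
  "vector_space s \<Longrightarrow> s c (tlift2 H f t) = tlift2 H (\<lambda>x y. s c (f x y)) t"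
  by (rule linear_tlift2[of s s])
     (simp add: Vector_Spaces.linear_iff vector_space.vector_space_assms mult.commute)

lemma tlift2_cong: "(\<And>x y. f x y = g x y) \<Longrightarrow> tlift2 H f t = tlift2 H g t"
  by (rule arg_cong[of f g "\<lambda>f. tlift2 H f t"]) (intro ext)

lemma linear_tlift2_fun:
  assumes "\<And>p q. Vector_Spaces.linear s s' (\<lambda>x. f x p q)"
  shows "Vector_Spaces.linear s s' (\<lambda>x. tlift2 H (f x) t)"
  unfolding tlift2_def tlift_def
  by (rule linear_sum_list_pointwise[OF linear_domain[OF assms] linear_codomain[OF assms]])
     (simp add: assms case_prod_unfold)

lemma linear_tlift3_fun:
  assumes "\<And>p q r. Vector_Spaces.linear s s' (\<lambda>x. f x p q r)"
  shows "Vector_Spaces.linear s s' (\<lambda>x. tlift3 H (f x) t)"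
  unfolding tlift3_def tlift_def
  by (rule linear_sum_list_pointwise[OF linear_domain[OF assms] linear_codomain[OF assms]])
     (simp add: assms case_prod_unfold)

lemma linear_tlift2_arg:
  assumes "bil H s f" "Vector_Spaces.linear r tscale T" "\<And>x. T x \<in> tensors2 H"
  shows "Vector_Spaces.linear r s (\<lambda>x. tlift2 H f (T x))"
  unfolding tlift2_def
  by (rule tlift_linear[OF bil_codomain[OF assms(1)]])
     (use assms in \<open>auto simp: tensors2_def intro: bil_form[OF assms(1)]\<close>)

section \<open>Sweedler sums\<close>

text \<open>
  The axioms under which an integral is recovered below from the coproduct of a single element.  For
  the twist of a Hopf algebra, coassociativity is the one among them that rests on the twist equation.
\<close>

locale pointed_coalgebra =
  fixes H :: "('k::field, 'a::ring_1) hopf"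
  assumes vector_space_smult: "vector_space (smult H)"
    and smult_mult_left: "smult H c x * y = smult H c (x * y)"
    and smult_mult_right: "x * smult H c y = smult H c (x * y)"
    and comult_tensors2: "comult H x \<in> tensors2 H"
    and comult_linear: "Vector_Spaces.linear (smult H) tscale (comult H)"
    and comult_one: "comult H 1 = tens2 H 1 1"
    and coassoc: "comult_id H (comult H x) = id_comult H (comult H x)"
begin

text \<open>
  \<open>sw x (\<lambda>p q. f p q)\<close> is the Sweedler expression f(x1, x2).
\<close>

abbreviation sw :: "'a \<Rightarrow> ('a \<Rightarrow> 'a \<Rightarrow> 'v::ab_group_add) \<Rightarrow> 'v" where
  "sw x f \<equiv> tlift2 H f (comult H x)"

sublocale V: vector_space "smult H" by (rule vector_space_smult)

lemma lin_id: "lin H (smult H) (\<lambda>x. x)"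
  by (simp add: Vector_Spaces.linear_iff vector_space_smult)

lemma lin_mult_const: "lin H (smult H) (\<lambda>x. x * c)"
  by (simp add: Vector_Spaces.linear_iff vector_space_smult distrib_right smult_mult_left)

lemma lin_const_mult: "lin H (smult H) (\<lambda>x. c * x)"
  by (simp add: Vector_Spaces.linear_iff vector_space_smult distrib_left smult_mult_right)

lemma lin_mult1: "Vector_Spaces.linear r (smult H) f \<Longrightarrow> Vector_Spaces.linear r (smult H) (\<lambda>x. f x * c)"
  by (rule linear_compose_form[OF _ lin_mult_const])

lemma lin_mult2: "Vector_Spaces.linear r (smult H) f \<Longrightarrow> Vector_Spaces.linear r (smult H) (\<lambda>x. c * f x)"
  by (rule linear_compose_form[OF _ lin_const_mult])

lemma linear_scale_const:
  "vector_space s \<Longrightarrow> lin H (*) \<phi> \<Longrightarrow> lin H s (\<lambda>x. s (\<phi> x) v)"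
  unfolding Vector_Spaces.linear_iff
  by (simp add: vector_space.vector_space_assms)

lemma linear_const_scale:
  "lin H s f \<Longrightarrow> lin H s (\<lambda>x. s c (f x))"
  unfolding Vector_Spaces.linear_iff
  by (simp add: vector_space.vector_space_assms mult.commute)

lemmas lin_smult1 = linear_scale_const[OF vector_space_smult]
lemmas lin_smult2 = linear_const_scale[where s = "smult H"]
lemmas lin_times1 = linear_scale_const[OF vector_space_field]
lemmas lin_times2 = linear_const_scale[where s = "(*)"]

lemma lin_sw: "bil H s f \<Longrightarrow> lin H (smult H) g \<Longrightarrow> lin H s (\<lambda>x. sw (g x) f)"
  by (rule linear_tlift2_arg) (auto intro: linear_compose_form comult_linear comult_tensors2)

text \<open>
  The multilinearity of a Sweedler expression in each of its letters is checked by rewriting with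
  these rules; the collections derived from them add the antipode, its inverse, the counit and
  the integral.
\<close>

lemmas lins = lin_id lin_mult1 lin_mult2 lin_smult1 lin_smult2 lin_times1 lin_times2
  linear_tlift2_fun linear_tlift3_fun lin_sw bil_def tril_def

lemma bil1: "bil H s f \<Longrightarrow> lin H (smult H) g \<Longrightarrow> lin H s (\<lambda>x. f (g x) y)"
  and bil2: "bil H s f \<Longrightarrow> lin H (smult H) g \<Longrightarrow> lin H s (\<lambda>y. f x (g y))"
  unfolding bil_def by (auto elim: linear_compose_form)

lemma tril1: "tril H s f \<Longrightarrow> lin H (smult H) g \<Longrightarrow> lin H s (\<lambda>x. f (g x) y z)"
  and tril2: "tril H s f \<Longrightarrow> lin H (smult H) g \<Longrightarrow> lin H s (\<lambda>y. f x (g y) z)"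
  and tril3: "tril H s f \<Longrightarrow> lin H (smult H) g \<Longrightarrow> lin H s (\<lambda>z. f x y (g z))"
  unfolding tril_def
  by (auto elim: linear_compose_form)

lemma sw_coassoc:
  assumes f: "tril H s f"
  shows "sw x (\<lambda>p q. sw p (\<lambda>u v. f u v q)) = sw x (\<lambda>p q. sw q (\<lambda>u v. f p u v))"
proof -
  have "tlift3 H f (comult_id H (comult H x)) = tlift3 H f (id_comult H (comult H x))"
    by (simp add: coassoc)
  then show ?thesis unfolding comult_id_def id_comult_def
    by (simp add: tlift3_tlift2[OF f] tlift2_in_tensors3 tlift3_tens3[OF f])
qed

lemma sw_one: "bil H s f \<Longrightarrow> sw 1 f = f 1 1"
  by (simp add: comult_one tlift2_tens2)

lemma tmult2_lift:
  assumes f: "bil H s f"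
  shows "tlift2 H f (tmult2 H t u) = tlift2 H (\<lambda>a b. tlift2 H (\<lambda>c d. f (a * c) (b * d)) u) t"
  unfolding tmult2_def by (simp add: tlift2_tlift2[OF f] tlift2_in_tensors2 tlift2_tens2[OF f])

lemma tmult2_in: "tmult2 H t u \<in> tensors2 H"
  unfolding tmult2_def by (simp add: tlift2_in_tensors2)

lemmas mult_tlift2 = linear_tlift2[OF lin_const_mult]
lemmas tlift2_mult = linear_tlift2[OF lin_mult_const]

lemma scalar_tlift2: "smult H (tlift2 H' f t) v = tlift2 H' (\<lambda>x y. smult H (f x y) v) t"
  by (rule linear_tlift2[where s = "(*)" and s' = "smult H"])
     (simp add: Vector_Spaces.linear_iff vector_space_smult vector_space_field V.scale_left_distrib)

lemmas tlift2_smult = linear_tlift2[OF lin_smult2, OF lin_id]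

end

section \<open>The antipode and invariance of integrals\<close>

context hopf_algebra
begin

sublocale pointed_coalgebra H
  by (intro pointed_coalgebra.intro vector_space_smult smult_mult_left smult_mult_right comult_tensors2
      comult_linear comult_one coassoc)

abbreviation S :: "'a \<Rightarrow> 'a" where "S \<equiv> antipode H"
abbreviation \<epsilon> :: "'a \<Rightarrow> 'k" where "\<epsilon> \<equiv> counit H"
abbreviation scale (infixr "\<cdot>" 75) where "scale \<equiv> smult H"

lemma lin_S: "lin H (smult H) f \<Longrightarrow> lin H (smult H) (\<lambda>x. S (f x))"
  by (rule linear_compose_form[OF _ antipode_linear])

lemma lin_counit: "lin H (smult H) f \<Longrightarrow> lin H (*) (\<lambda>x. \<epsilon> (f x))"
  by (rule linear_compose_form[OF _ counit_linear])

lemmas hopf_lins = lins lin_S lin_counit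

lemma sw_mult:
  assumes f: "bil H s f"
  shows "sw (x * y) f = sw x (\<lambda>p q. sw y (\<lambda>u v. f (p * u) (q * v)))"
  by (simp add: comult_mult tmult2_lift[OF f])

lemma sw_counit_left:
  assumes f: "lin H s f"
  shows "sw x (\<lambda>p q. s (\<epsilon> p) (f q)) = f x"
proof -
  have "f x = f (counit_id H (comult H x))" by (simp add: counit_left)
  also have "\<dots> = sw x (\<lambda>p q. s (\<epsilon> p) (f q))"
    unfolding counit_id_def using f
    by (simp add: linear_tlift2[OF f] Vector_Spaces.linear_iff)
  finally show ?thesis ..
qed

lemma sw_counit_right:
  assumes f: "lin H s f"
  shows "sw x (\<lambda>p q. s (\<epsilon> q) (f p)) = f x"
proof -
  have "f x = f (id_counit H (comult H x))" by (simp add: counit_right)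
  also have "\<dots> = sw x (\<lambda>p q. s (\<epsilon> q) (f p))"
    unfolding id_counit_def using f
    by (simp add: linear_tlift2[OF f] Vector_Spaces.linear_iff)
  finally show ?thesis ..
qed

lemma sw_antipode_left:
  assumes f: "lin H s f"
  shows "sw x (\<lambda>p q. f (S p * q)) = s (\<epsilon> x) (f 1)"
  using arg_cong[OF antipode_left[of x], of f] f
  by (simp add: linear_tlift2[OF f]) (simp add: Vector_Spaces.linear_iff)

lemma sw_antipode_right:
  assumes f: "lin H s f"
  shows "sw x (\<lambda>p q. f (p * S q)) = s (\<epsilon> x) (f 1)"
  using arg_cong[OF antipode_right[of x], of f] f
  by (simp add: linear_tlift2[OF f]) (simp add: Vector_Spaces.linear_iff)

lemmas sw_laws = sw_mult[where s = "smult H"] sw_counit_left[where s = "smult H"]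
  sw_counit_right[where s = "smult H"]
  sw_antipode_left[where s = "smult H"] sw_antipode_right[where s = "smult H"]

lemma S_one: "S 1 = 1"
  using antipode_left[of 1] sw_one[of "smult H" "\<lambda>x y. S x * y"] by (simp add: hopf_lins counit_one)

text \<open>
  Both sides are convolution inverses of multiplication: the computation inserts x2 S(x3) and y2 S(y3)
  into S(x1 y1) and contracts S(x1 y1) x2 y2.
\<close>

lemma S_mult: "S (x * y) = S y * S x"
proof -
  have "S (x * y) = sw x (\<lambda>p q. \<epsilon> q \<cdot> S (p * y))"
    by (simp add: sw_laws(3) hopf_lins)
  also have "\<dots> = sw x (\<lambda>p q. sw y (\<lambda>r t. \<epsilon> t \<cdot> (\<epsilon> q \<cdot> S (p * r))))"
    by (simp add: sw_laws(3) hopf_lins del: V.scale_scale)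
  also have "\<dots> = sw x (\<lambda>p q. sw y (\<lambda>r t. \<epsilon> t \<cdot> sw q (\<lambda>u v. S (p * r) * (u * S v))))"
    by (simp add: sw_laws(5) hopf_lins)
  also have "\<dots> = sw x (\<lambda>p q. sw y (\<lambda>r t. sw q (\<lambda>u v. sw t (\<lambda>w z. S (p * r) * (u * (w * S z) * S v)))))"
    by (subst sw_antipode_right[where s = "smult H"]) (simp_all add: hopf_lins tlift2_smult)
  also have "\<dots> = sw x (\<lambda>p q. sw q (\<lambda>u v. sw y (\<lambda>r t. sw t (\<lambda>w z. S (p * r) * (u * (w * S z) * S v)))))"
    by (intro tlift2_cong tlift2_commute)
  also have "\<dots> = sw x (\<lambda>p q. sw q (\<lambda>u v. sw y (\<lambda>r t. sw r (\<lambda>w z. S (p * w) * (u * (z * S t) * S v)))))"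
    by (rule tlift2_cong, rule tlift2_cong, rule sw_coassoc[where s = "smult H", symmetric])
       (simp add: hopf_lins)
  also have "\<dots> = sw x (\<lambda>p q. sw p (\<lambda>u v. sw y (\<lambda>r t. sw r (\<lambda>w z. S (u * w) * (v * (z * S t) * S q)))))"
    by (rule sw_coassoc[where s = "smult H", symmetric])
       (simp add: hopf_lins)
  also have "\<dots> = sw x (\<lambda>p q. sw y (\<lambda>r t. sw p (\<lambda>u v. sw r (\<lambda>w z. S (u * w) * (v * z) * (S t * S q)))))"
    by (intro tlift2_cong) (subst tlift2_commute, simp add: mult.assoc)
  also have "\<dots> = sw x (\<lambda>p q. sw y (\<lambda>r t. sw (p * r) (\<lambda>u v. S u * v * (S t * S q))))"
    by (simp add: sw_laws(1) hopf_lins)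
  also have "\<dots> = sw x (\<lambda>p q. \<epsilon> p \<cdot> sw y (\<lambda>r t. \<epsilon> r \<cdot> (S t * S q)))"
    by (simp add: tlift2_mult[symmetric] antipode_left counit_mult smult_mult_left tlift2_smult)
  also have "\<dots> = S y * S x"
    by (simp add: sw_laws(2) hopf_lins)
  finally show ?thesis .
qed

text \<open>
  This is l(x1) x2 = l(x) 1 at x = ab1, multiplied by S(b2) on the right: on the left-hand side the
  factor b2 S(b3) contracts.
\<close>

lemma dual_integral_shift:
  assumes l: "dual_right_integral H l"
  shows "sw a (\<lambda>p q. l (p * b) \<cdot> q) = sw b (\<lambda>r t. l (a * r) \<cdot> S t)"
proof -
  have lin: "lin H (*) l" using l by (simp add: dual_right_integral_def)
  have l_lin: "lin H (*) (\<lambda>x. l (f x))" if "lin H (smult H) f" for f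
    by (rule linear_compose_form[OF that lin])
  have "sw b (\<lambda>r t. l (a * r) \<cdot> S t) = sw b (\<lambda>r t. sw (a * r) (\<lambda>u v. l u \<cdot> v) * S t)"
    using l by (simp add: dual_right_integral_def smult_mult_left)
  also have "\<dots> = sw b (\<lambda>r t. sw a (\<lambda>p q. sw r (\<lambda>u v. l (p * u) \<cdot> (q * v * S t))))"
    by (simp add: tlift2_mult sw_laws(1) hopf_lins l_lin smult_mult_left)
  also have "\<dots> = sw a (\<lambda>p q. sw b (\<lambda>r t. sw r (\<lambda>u v. l (p * u) \<cdot> (q * v * S t))))"
    by (rule tlift2_commute)
  also have "\<dots> = sw a (\<lambda>p q. sw b (\<lambda>r t. sw t (\<lambda>u v. l (p * r) \<cdot> (q * u * S v))))"
    by (rule tlift2_cong, rule sw_coassoc[where s = "smult H"]) (simp add: hopf_lins l_lin)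
  also have "\<dots> = sw a (\<lambda>p q. sw b (\<lambda>r t. \<epsilon> t \<cdot> (l (p * r) \<cdot> q)))"
  proof (rule tlift2_cong, rule tlift2_cong)
    fix p q r t
    show "sw t (\<lambda>u v. l (p * r) \<cdot> (q * u * S v)) = \<epsilon> t \<cdot> (l (p * r) \<cdot> q)"
      using sw_antipode_right[of "smult H" "\<lambda>x. l (p * r) \<cdot> (q * x)" t]
      by (simp add: hopf_lins mult.assoc)
  qed
  also have "\<dots> = sw a (\<lambda>p q. l (p * b) \<cdot> q)"
    by (simp add: sw_laws(3) hopf_lins l_lin del: V.scale_scale)
  finally show ?thesis ..
qed

text \<open>
  As h2 \<Lambda> is a multiple of \<Lambda>, inserting S(h1) h2 on the left of the first leg and using
  \<Delta>(h2) \<Delta>(\<Lambda>) = \<Delta>(h2 \<Lambda>) trades a factor of the second leg for its antipode in the first.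
\<close>

lemma left_integral_shift:
  assumes L: "left_integral H \<Lambda>" and f: "bil H s f"
  shows "sw \<Lambda> (\<lambda>p q. f (S h * p) q) = sw \<Lambda> (\<lambda>p q. f p (h * q))"
proof -
  note f_lin = bil1[OF f] bil2[OF f]
  have fs: "f (c \<cdot> x) y = s c (f x y)" for c x y
    using f unfolding bil_def Vector_Spaces.linear_iff by blast
  note sw_s = scale_tlift2[OF bil_codomain[OF f]]
  have "sw \<Lambda> (\<lambda>p q. f p (h * q)) = sw h (\<lambda>u v. s (\<epsilon> u) (sw \<Lambda> (\<lambda>p q. f p (v * q))))"
    by (rule sw_counit_left[symmetric]) (simp add: hopf_lins f_lin)
  also have "\<dots> = sw h (\<lambda>u v. sw \<Lambda> (\<lambda>p q. sw u (\<lambda>w z. f (S w * z * p) (v * q))))"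
    by (intro tlift2_cong, subst sw_antipode_left[where s = s and f = "\<lambda>x. f (x * _) _"])
       (simp_all add: hopf_lins f_lin fs sw_s)
  also have "\<dots> = sw h (\<lambda>u v. sw u (\<lambda>w z. sw \<Lambda> (\<lambda>p q. f (S w * z * p) (v * q))))"
    by (rule tlift2_cong, rule tlift2_commute)
  also have "\<dots> = sw h (\<lambda>u v. sw v (\<lambda>w z. sw \<Lambda> (\<lambda>p q. f (S u * w * p) (z * q))))"
    by (rule sw_coassoc[where s = s]) (simp add: hopf_lins f_lin)
  also have "\<dots> = sw h (\<lambda>u v. sw (v * \<Lambda>) (\<lambda>p q. f (S u * p) q))"
    by (simp add: sw_mult[where s = s] hopf_lins f_lin mult.assoc)
  also have "\<dots> = sw h (\<lambda>u v. s (\<epsilon> v) (sw \<Lambda> (\<lambda>p q. f (S u * p) q)))"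
  proof (rule tlift2_cong)
    fix u v
    have "lin H s (\<lambda>x. sw x (\<lambda>p q. f (S u * p) q))" by (simp add: hopf_lins f_lin)
    then show "sw (v * \<Lambda>) (\<lambda>p q. f (S u * p) q) = s (\<epsilon> v) (sw \<Lambda> (\<lambda>p q. f (S u * p) q))"
      using L unfolding left_integral_def Vector_Spaces.linear_iff by simp
  qed
  also have "\<dots> = sw \<Lambda> (\<lambda>p q. f (S h * p) q)"
    by (rule sw_counit_right) (simp add: hopf_lins f_lin)
  finally show ?thesis ..
qed

lemma right_integral_shift:
  assumes R: "right_integral H \<Lambda>" and f: "bil H s f"
  shows "sw \<Lambda> (\<lambda>p q. f (p * h) q) = sw \<Lambda> (\<lambda>p q. f p (q * S h))"
proof -
  note f_lin = bil1[OF f] bil2[OF f]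
  have fs: "f x (c \<cdot> y) = s c (f x y)" for c x y
    using f unfolding bil_def Vector_Spaces.linear_iff by blast
  note sw_s = scale_tlift2[OF bil_codomain[OF f]]
  have "sw \<Lambda> (\<lambda>p q. f p (q * S h)) = sw h (\<lambda>u v. s (\<epsilon> u) (sw \<Lambda> (\<lambda>p q. f p (q * S v))))"
    by (rule sw_counit_left[symmetric]) (simp add: hopf_lins f_lin)
  also have "\<dots> = sw h (\<lambda>u v. sw (\<Lambda> * u) (\<lambda>p q. f p (q * S v)))"
  proof (rule tlift2_cong)
    fix u v
    have "lin H s (\<lambda>x. sw x (\<lambda>p q. f p (q * S v)))" by (simp add: hopf_lins f_lin)
    then show "s (\<epsilon> u) (sw \<Lambda> (\<lambda>p q. f p (q * S v))) = sw (\<Lambda> * u) (\<lambda>p q. f p (q * S v))"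
      using R unfolding right_integral_def Vector_Spaces.linear_iff by simp
  qed
  also have "\<dots> = sw h (\<lambda>u v. sw \<Lambda> (\<lambda>p q. sw u (\<lambda>w z. f (p * w) (q * (z * S v)))))"
    by (simp add: sw_mult[where s = s] hopf_lins f_lin mult.assoc)
  also have "\<dots> = sw h (\<lambda>u v. sw u (\<lambda>w z. sw \<Lambda> (\<lambda>p q. f (p * w) (q * (z * S v)))))"
    by (rule tlift2_cong, rule tlift2_commute)
  also have "\<dots> = sw h (\<lambda>u v. sw v (\<lambda>w z. sw \<Lambda> (\<lambda>p q. f (p * u) (q * (w * S z)))))"
    by (rule sw_coassoc[where s = s]) (simp add: hopf_lins f_lin)
  also have "\<dots> = sw h (\<lambda>u v. s (\<epsilon> v) (sw \<Lambda> (\<lambda>p q. f (p * u) (q * 1))))"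
    by (rule tlift2_cong, rule sw_antipode_right) (simp add: hopf_lins f_lin)
  also have "\<dots> = sw \<Lambda> (\<lambda>p q. f (p * h) q)"
    by (subst sw_counit_right) (simp_all add: hopf_lins f_lin)
  finally show ?thesis ..
qed

end

section \<open>Integrals determined by the coproduct of one element\<close>

text \<open>
  Nondegeneracy says that a linear form f is determined by f(\<Lambda>1) \<Lambda>2, so that every identity
  between forms can be checked on the coproduct of \<Lambda> alone.
\<close>

locale frobenius_coalgebra = pointed_coalgebra H for H :: "('k::field, 'a::ring_1) hopf" +
  fixes \<Lambda> :: 'a and l :: "'a \<Rightarrow> 'k"
  assumes l_linear: "lin H (*) l"
    and l_normalized: "sw \<Lambda> (\<lambda>p q. smult H (l p) q) = 1"
    and nondegenerate: "\<And>f x. lin H (*) f \<Longrightarrow> sw \<Lambda> (\<lambda>p q. smult H (f p) q) = 0 \<Longrightarrow> f x = 0"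
begin

lemma lin_l: "lin H (smult H) f \<Longrightarrow> lin H (*) (\<lambda>x. l (f x))"
  by (rule linear_compose_form[OF _ l_linear])

lemma form_unique:
  assumes f: "lin H (*) f" and eq: "sw \<Lambda> (\<lambda>p q. smult H (f p) q) = smult H c 1"
  shows "f x = c * l x"
proof -
  interpret p: vector_space_pair "smult H" "(*) :: 'k \<Rightarrow> 'k \<Rightarrow> 'k"
    by (intro vector_space_pair.intro vector_space_smult vector_space_field)
  have lin: "lin H (*) (\<lambda>x. f x - c * l x)"
    by (rule p.linear_compose_sub[OF f linear_const_scale[OF l_linear]])
  have "sw \<Lambda> (\<lambda>p q. smult H (f p) q) = sw \<Lambda> (\<lambda>p q. smult H (f p - c * l p) q + smult H (c * l p) q)"
    by (simp add: V.scale_left_distrib[symmetric])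
  also have "\<dots> = sw \<Lambda> (\<lambda>p q. smult H (f p - c * l p) q) + sw \<Lambda> (\<lambda>p q. smult H (c * l p) q)"
    by (simp add: tlift2_def tlift_def case_prod_unfold sum_list_addf)
  also have "sw \<Lambda> (\<lambda>p q. smult H (c * l p) q) = smult H c 1"
    by (simp add: tlift2_smult[symmetric] V.scale_scale[symmetric] l_normalized del: V.scale_scale)
  finally have "sw \<Lambda> (\<lambda>p q. smult H (f p - c * l p) q) = 0"
    using eq by simp
  from nondegenerate[OF lin this] show ?thesis by simp
qed

text \<open>
  For every form \<phi>, let f be the convolution product of l with \<phi>.  Coassociativity and
  l(\<Lambda>1) \<Lambda>2 = 1 give f(\<Lambda>1) \<Lambda>2 = \<phi>(1) 1, and so f = \<phi>(1) l by nondegeneracy.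
\<close>

lemma l_right_integral: "dual_right_integral H l"
  unfolding dual_right_integral_def
proof (intro conjI allI l_linear V.linear_forms_separate)
  fix a \<phi> assume \<phi>: "lin H (*) \<phi>"
  note plins = lins lin_l linear_compose_form[OF _ \<phi>] linear_tlift2[OF \<phi>]
  have \<phi>s: "\<phi> (smult H c x) = c * \<phi> x" for c x using \<phi> by (simp add: Vector_Spaces.linear_iff)
  define G where "G x = sw x (\<lambda>u v. smult H (\<phi> u) v)" for x
  have G: "lin H (smult H) G" unfolding G_def by (simp add: plins)
  have "sw \<Lambda> (\<lambda>p q. smult H (sw p (\<lambda>u v. l u * \<phi> v)) q)
      = sw \<Lambda> (\<lambda>p q. sw p (\<lambda>u v. smult H (l u * \<phi> v) q))"
    by (simp only: scalar_tlift2)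
  also have "\<dots> = sw \<Lambda> (\<lambda>p q. sw q (\<lambda>u v. smult H (l p * \<phi> u) v))"
    by (rule sw_coassoc[where s = "smult H"]) (simp add: plins)
  also have "\<dots> = sw \<Lambda> (\<lambda>p q. G (smult H (l p) q))"
    using G by (simp add: Vector_Spaces.linear_iff) (simp add: G_def tlift2_smult)
  also have "\<dots> = G 1"
    by (simp add: linear_tlift2[OF G, symmetric] l_normalized)
  also have "G 1 = smult H (\<phi> 1) 1" unfolding G_def
    by (rule sw_one[where s = "smult H"]) (simp add: plins)
  finally have "sw a (\<lambda>u v. l u * \<phi> v) = \<phi> 1 * l a"
    by (intro form_unique) (simp add: plins)
  then show "\<phi> (sw a (\<lambda>a1 a2. smult H (l a1) a2)) = \<phi> (smult H (l a) 1)"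
    by (simp add: plins \<phi>s mult.commute)
qed

lemma right_integral_unique:
  assumes "dual_right_integral H l'"
  shows "l' x = l' \<Lambda> * l x"
  using assms unfolding dual_right_integral_def by (intro form_unique) auto

lemma l_Lambda: "l \<Lambda> = 1"
proof -
  have "smult H (l \<Lambda>) 1 = smult H 1 1"
    using l_normalized l_right_integral unfolding dual_right_integral_def by simp
  then show ?thesis by (simp add: V.scale_cancel_right del: V.scale_one)
qed

definition g where "g = sw \<Lambda> (\<lambda>p q. smult H (l q) p)"

text \<open>
  The convolution product of any form \<phi> with a right integral is again a right integral, hence a
  multiple of l; its value at \<Lambda> is \<phi>(g).
\<close>

lemma l_right_g: "sw a (\<lambda>p q. smult H (l q) p) = smult H (l a) g"
proof (intro V.linear_forms_separate)
  fix \<phi> assume \<phi>: "lin H (*) \<phi>"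
  note plins = lins lin_l linear_compose_form[OF _ \<phi>] linear_tlift2[OF \<phi>]
  have \<phi>s: "\<phi> (smult H c x) = c * \<phi> x" for c x using \<phi> by (simp add: Vector_Spaces.linear_iff)
  define m where "m x = sw x (\<lambda>u v. \<phi> u * l v)" for x
  have "dual_right_integral H m"
    unfolding dual_right_integral_def
  proof (intro conjI allI)
    show "lin H (*) m" unfolding m_def by (simp add: plins)
    fix a
    have "sw a (\<lambda>p q. smult H (m p) q) = sw a (\<lambda>p q. sw p (\<lambda>u v. smult H (\<phi> u * l v) q))"
      unfolding m_def by (simp add: scalar_tlift2)
    also have "\<dots> = sw a (\<lambda>p q. sw q (\<lambda>u v. smult H (\<phi> p * l u) v))"
      by (rule sw_coassoc[where s = "smult H"]) (simp add: plins)
    also have "\<dots> = sw a (\<lambda>p q. smult H (\<phi> p) (sw q (\<lambda>u v. smult H (l u) v)))"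
      by (simp add: tlift2_smult)
    also have "\<dots> = sw a (\<lambda>p q. smult H (\<phi> p * l q) 1)"
      using l_right_integral unfolding dual_right_integral_def by simp
    also have "\<dots> = smult H (m a) 1"
      unfolding m_def by (simp add: scalar_tlift2)
    finally show "sw a (\<lambda>p q. smult H (m p) q) = smult H (m a) 1" .
  qed
  from right_integral_unique[OF this, of a]
  show "\<phi> (sw a (\<lambda>p q. smult H (l q) p)) = \<phi> (smult H (l a) g)"
    by (simp add: plins \<phi>s m_def g_def mult.commute)
qed

lemma distinguished_grouplike_eq: "distinguished_grouplike H = g"
  unfolding distinguished_grouplike_def
proof (rule the_equality)
  show "\<exists>l. dual_right_integral H l \<and> l \<noteq> (\<lambda>_. 0) \<and>
    (\<forall>a. sw a (\<lambda>a1 a2. smult H (l a2) a1) = smult H (l a) g)"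
    using l_right_integral l_right_g l_Lambda by (intro exI[of _ l]) (auto dest: fun_cong[of _ _ \<Lambda>])
next
  fix h assume "\<exists>l. dual_right_integral H l \<and> l \<noteq> (\<lambda>_. 0) \<and>
    (\<forall>a. sw a (\<lambda>a1 a2. smult H (l a2) a1) = smult H (l a) h)"
  then obtain l' where l': "dual_right_integral H l'" "l' \<noteq> (\<lambda>_. 0)"
    "\<And>a. sw a (\<lambda>a1 a2. smult H (l' a2) a1) = smult H (l' a) h" by auto
  note eq = right_integral_unique[OF l'(1)]
  have ne: "l' \<Lambda> \<noteq> 0" using l'(2) eq by (metis (no_types) ext mult_zero_left)
  have "smult H (l' \<Lambda>) h = sw \<Lambda> (\<lambda>a1 a2. smult H (l' \<Lambda>) (smult H (l a2) a1))"
    using l'(3)[of \<Lambda>] by (simp add: eq[symmetric])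
  also have "\<dots> = smult H (l' \<Lambda>) g"
    by (simp only: tlift2_smult[symmetric] g_def)
  finally show "h = g" using ne by (simp add: V.scale_cancel_left)
qed

end

section \<open>Radford's formula for unimodular Hopf algebras\<close>

locale unimodular_hopf = hopf_algebra H for H :: "('k::field, 'a::ring_1) hopf" +
  fixes \<Lambda> :: 'a and l :: "'a \<Rightarrow> 'k"
  assumes finite_dim: "finite_dim H"
    and Lambda_left: "left_integral H \<Lambda>"
    and Lambda_right: "right_integral H \<Lambda>"
    and l_integral: "dual_right_integral H l"
    and l_Lambda_one: "l \<Lambda> = 1"
begin

lemma l_lin: "lin H (*) l"
  using l_integral by (simp add: dual_right_integral_def)

lemma l_comp: "lin H (smult H) f \<Longrightarrow> lin H (*) (\<lambda>x. l (f x))"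
  by (rule linear_compose_form[OF _ l_lin])

lemma l_scale: "l (c \<cdot> x) = c * l x"
  using l_lin by (simp add: Vector_Spaces.linear_iff)

lemma inj_imp_surj: "lin H (smult H) f \<Longrightarrow> inj f \<Longrightarrow> surj f"
  and surj_imp_inj: "lin H (smult H) f \<Longrightarrow> surj f \<Longrightarrow> inj f"
proof -
  obtain B where "finite_dimensional_vector_space (smult H) B"
    using finite_dim unfolding finite_dim_def by blast
  then interpret finite_dimensional_vector_space "smult H" B .
  show "lin H (smult H) f \<Longrightarrow> inj f \<Longrightarrow> surj f" by (rule linear_inj_imp_surj)
  show "lin H (smult H) f \<Longrightarrow> surj f \<Longrightarrow> inj f" by (rule linear_surj_imp_inj)
qed

lemma left_mult_Lambda: "sw a (\<lambda>p q. l (p * \<Lambda>) \<cdot> q) = a"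
proof -
  have "sw a (\<lambda>p q. l (p * \<Lambda>) \<cdot> q) = sw a (\<lambda>p q. \<epsilon> p \<cdot> q)"
    using Lambda_left by (simp add: left_integral_def l_scale l_Lambda_one)
  then show ?thesis by (simp add: sw_laws(2) hopf_lins)
qed

text \<open>
  This lemma and the next are \<open>dual_integral_shift\<close> with \<Lambda> in place of b and of a.  They express the
  antipode and a right inverse of it through \<Lambda> and l; being surjective, the antipode is bijective by
  finite dimension.
\<close>

lemma S_Lambda_left: "S (sw \<Lambda> (\<lambda>p q. l (a * p) \<cdot> q)) = a"
proof -
  have "S (sw \<Lambda> (\<lambda>p q. l (a * p) \<cdot> q)) = sw \<Lambda> (\<lambda>p q. l (a * p) \<cdot> S q)"
    using antipode_linear by (simp add: linear_tlift2[OF antipode_linear] Vector_Spaces.linear_iff)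
  then show ?thesis using dual_integral_shift[OF l_integral, where a = a and b = \<Lambda>]
      left_mult_Lambda[of a] by simp
qed

lemma Lambda_S: "sw \<Lambda> (\<lambda>p q. l (p * b) \<cdot> q) = S b"
proof -
  have "sw b (\<lambda>r t. l (\<Lambda> * r) \<cdot> S t) = sw b (\<lambda>r t. \<epsilon> r \<cdot> S t)"
    using Lambda_right by (simp add: right_integral_def l_scale l_Lambda_one)
  then show ?thesis using dual_integral_shift[OF l_integral, where a = \<Lambda> and b = b]
    by (simp add: sw_laws(2) hopf_lins)
qed

lemma bij_S: "bij S"
proof -
  have "surj S" by (rule surjI) (rule S_Lambda_left)
  then show ?thesis using surj_imp_inj[OF antipode_linear] by (simp add: bij_def)
qed

abbreviation Si :: "'a \<Rightarrow> 'a" where "Si \<equiv> inv S"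

lemma S_Si [simp]: "S (Si x) = x"
  using bij_S by (simp add: bij_def surj_f_inv_f)

lemma Si_S [simp]: "Si (S x) = x"
  using bij_S by (simp add: bij_def inv_f_f)

lemma S_eq_iff: "S x = S y \<longleftrightarrow> x = y"
  using bij_S by (metis Si_S)

lemma Si_mult: "Si (x * y) = Si y * Si x"
  using S_eq_iff[of "Si (x * y)" "Si y * Si x"] by (simp add: S_mult)

lemma Si_linear: "lin H (smult H) Si"
proof -
  note S = antipode_linear[unfolded Vector_Spaces.linear_iff]
  have "Si (x + y) = Si x + Si y" for x y
    using S_eq_iff[of "Si (x + y)" "Si x + Si y"] S by simp
  moreover have "Si (c \<cdot> x) = c \<cdot> Si x" for c x
    using S_eq_iff[of "Si (c \<cdot> x)" "c \<cdot> Si x"] S by simp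
  ultimately show ?thesis by (simp add: Vector_Spaces.linear_iff vector_space_smult)
qed

lemma lin_Si: "lin H (smult H) f \<Longrightarrow> lin H (smult H) (\<lambda>x. Si (f x))"
  by (rule linear_compose_form[OF _ Si_linear])

lemmas unimodular_lins = hopf_lins lin_Si l_comp

lemma Lambda_Si: "sw \<Lambda> (\<lambda>p q. l (a * p) \<cdot> q) = Si a"
  using S_Lambda_left[of a] by (metis Si_S)

text \<open>
  If \<Lambda>1 l(\<Lambda>2 b) vanishes then l(S(c) b) = l(\<Lambda>1 c) l(\<Lambda>2 b) = 0 for all c, and so S(b) = l(\<Lambda>1 b) \<Lambda>2 = 0.
  The map is thus injective on a space of finite dimension.
\<close>

lemma surj_Lambda_right: "surj (\<lambda>b. sw \<Lambda> (\<lambda>p q. l (q * b) \<cdot> p))"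
proof -
  let ?P = "\<lambda>b. sw \<Lambda> (\<lambda>p q. l (q * b) \<cdot> p)"
  have lin: "lin H (smult H) ?P" by (simp add: unimodular_lins)
  interpret P: Vector_Spaces.linear "smult H" "smult H" ?P by (rule lin)
  have "b = 0" if b: "?P b = 0" for b
  proof -
    have "l (S c * b) = 0" for c
    proof -
      have "l (S c * b) = l (sw \<Lambda> (\<lambda>p q. l (p * c) \<cdot> q) * b)" by (simp add: Lambda_S)
      also have "\<dots> = sw \<Lambda> (\<lambda>p q. l (p * c) * l (q * b))"
        by (simp add: tlift2_mult linear_tlift2[OF l_lin] l_scale smult_mult_left)
      also have "\<dots> = l (?P b * c)"
        by (simp add: tlift2_mult linear_tlift2[OF l_lin] l_scale smult_mult_left mult.commute)
      finally show ?thesis using b l_scale[of 0 0] by simp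
    qed
    then have "l (d * b) = 0" for d by (metis S_Si)
    then have "S b = 0" using Lambda_S[of b] by (simp add: tlift2_def tlift_def case_prod_unfold)
    moreover have "S 0 = 0" using antipode_linear
      by (simp add: linear_sum_list[of _ _ S "\<lambda>x. x" "[]", simplified])
    ultimately show "b = 0" by (metis Si_S)
  qed
  then have "inj ?P" using P.inj_iff_eq_0 by blast
  then show ?thesis by (rule inj_imp_surj[OF lin])
qed

sublocale frobenius_coalgebra H \<Lambda> l
proof (intro frobenius_coalgebra.intro pointed_coalgebra_axioms frobenius_coalgebra_axioms.intro)
  show "lin H (*) l" by (rule l_lin)
  show "sw \<Lambda> (\<lambda>p q. l p \<cdot> q) = 1" using l_integral by (simp add: dual_right_integral_def l_Lambda_one)
  fix f x assume f: "lin H (*) f" and 0: "sw \<Lambda> (\<lambda>p q. f p \<cdot> q) = 0"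
  \<comment> \<open>Since x = \<Lambda>1 l(\<Lambda>2 b), the value f(x) is l applied to f(\<Lambda>1) \<Lambda>2 b.\<close>
  obtain b where x: "x = sw \<Lambda> (\<lambda>p q. l (q * b) \<cdot> p)" using surjD[OF surj_Lambda_right, of x] by blast
  have "f x = l (sw \<Lambda> (\<lambda>p q. f p \<cdot> q) * b)" unfolding x
    using f by (simp add: linear_tlift2[OF f] tlift2_mult linear_tlift2[OF l_lin] l_scale
      smult_mult_left Vector_Spaces.linear_iff mult.commute)
  then show "f x = 0" using 0 l_scale[of 0 0] by simp
qed

text \<open>
  Both forms pair with \<Lambda> to S(b).
\<close>

lemma l_cyclic: "l (x * b) = l (S (S b) * x)"
proof -
  interpret p: vector_space_pair "smult H" "(*) :: 'k \<Rightarrow> 'k \<Rightarrow> 'k"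
    by (intro vector_space_pair.intro vector_space_smult vector_space_field)
  have "sw \<Lambda> (\<lambda>p q. (l (p * b) - l (S (S b) * p)) \<cdot> q) =
    sw \<Lambda> (\<lambda>p q. l (p * b) \<cdot> q) - sw \<Lambda> (\<lambda>p q. l (S (S b) * p) \<cdot> q)"
    by (simp add: tlift2_def tlift_def case_prod_unfold sum_list_subtractf V.scale_left_diff_distrib)
  also have "\<dots> = 0" by (simp add: Lambda_S Lambda_Si)
  finally have "l (x * b) - l (S (S b) * x) = 0"
    by (intro nondegenerate[where f = "\<lambda>x. l (x * b) - l (S (S b) * x)"] p.linear_compose_sub)
       (simp_all add: unimodular_lins)
  then show ?thesis by simp
qed

text \<open>
  Coassociativity moves the coproduct of g = \<Lambda>1 l(\<Lambda>2) to the second leg, where \<open>l_right_g\<close> evaluates it.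
\<close>

lemma sw_g:
  assumes f: "bil H s f"
  shows "sw g f = f g g"
proof -
  note f_lin = bil1[OF f] bil2[OF f]
  have vs: "vector_space s" by (rule bil_codomain[OF f])
  have fs: "f x (c \<cdot> y) = s c (f x y)" "f (c \<cdot> x) y = s c (f x y)" for c x y
    using f unfolding bil_def Vector_Spaces.linear_iff by blast+
  have lf: "lin H s (\<lambda>x. sw x f)" by (simp add: unimodular_lins f_lin)
  then have sws: "sw (c \<cdot> x) f = s c (sw x f)" for c x by (simp add: Vector_Spaces.linear_iff)
  note s_sw = scale_tlift2[OF vs]
  have "sw g f = sw \<Lambda> (\<lambda>p q. sw p (\<lambda>u v. s (l q) (f u v)))"
    unfolding g_def by (simp add: linear_tlift2[OF lf] sws s_sw)
  also have "\<dots> = sw \<Lambda> (\<lambda>p q. sw q (\<lambda>u v. s (l v) (f p u)))"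
    by (rule sw_coassoc[where s = s])
      (simp add: unimodular_lins f_lin linear_scale_const[OF vs] linear_const_scale[where s = s])
  also have "\<dots> = sw \<Lambda> (\<lambda>p q. f p (sw q (\<lambda>u v. l v \<cdot> u)))"
    by (rule tlift2_cong, subst linear_tlift2[where s="smult H" and s'=s and g="f _"])
      (simp_all add: fs f_lin bil2[OF f lin_id])
  also have "\<dots> = sw \<Lambda> (\<lambda>p q. f (l q \<cdot> p) g)"
    by (simp add: l_right_g fs)
  also have "\<dots> = f g g"
    by (simp only: g_def linear_tlift2[OF bil1[OF f lin_id], symmetric])
  finally show ?thesis .
qed

lemma counit_g: "\<epsilon> g = 1"
proof -
  have "\<epsilon> g = l (sw \<Lambda> (\<lambda>p q. \<epsilon> p \<cdot> q))"
    unfolding g_def using counit_linear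
    by (simp add: linear_tlift2[OF counit_linear] linear_tlift2[OF l_lin] l_scale
        Vector_Spaces.linear_iff mult.commute)
  then show ?thesis by (simp add: sw_laws(2) unimodular_lins l_Lambda_one)
qed

lemma S_g: "S g * g = 1" "g * S g = 1"
  using antipode_left[of g] antipode_right[of g] sw_g[where s = "smult H" and
        f = "\<lambda>x y. S x * y"]
    sw_g[where s = "smult H" and
        f = "\<lambda>x y. x * S y"]
  by (simp_all add: unimodular_lins counit_g)

lemma ring_inverse_eq: "x * y = 1 \<Longrightarrow> y * x = 1 \<Longrightarrow> ring_inverse x = (y :: 'a)"
  unfolding ring_inverse_def
  by (rule the_equality) (auto, metis mult.assoc mult.left_neutral mult.right_neutral)

lemma Lambda_l_left: "sw \<Lambda> (\<lambda>p q. l (a * q) \<cdot> p) = S a * g"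
proof -
  have "sw \<Lambda> (\<lambda>p q. l (a * q) \<cdot> p) = sw \<Lambda> (\<lambda>p q. l q \<cdot> (S a * p))"
    by (rule left_integral_shift[OF Lambda_left, symmetric, where s = "smult H" and
        f = "\<lambda>p q. l q \<cdot> p"])
       (simp add: unimodular_lins)
  then show ?thesis by (simp add: g_def mult_tlift2 smult_mult_right)
qed

lemma Lambda_l_right: "sw \<Lambda> (\<lambda>p q. l (q * S c) \<cdot> p) = g * c"
proof -
  have "sw \<Lambda> (\<lambda>p q. l q \<cdot> (p * c)) = sw \<Lambda> (\<lambda>p q. l (q * S c) \<cdot> p)"
    by (rule right_integral_shift[OF Lambda_right, where s = "smult H" and
        f = "\<lambda>p q. l q \<cdot> p"])
       (simp add: unimodular_lins)
  then show ?thesis by (simp add: g_def tlift2_mult smult_mult_left)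
qed

text \<open>
  Both sides are \<Lambda>1 l(\<Lambda>2 S(c)), and their equality is Radford's formula: the factor S(c)
  is moved to the first leg directly, or after cycling it to the left of \<Lambda>2 under l.
\<close>

lemma S4_conjugation: "S (S (S (S c))) * g = g * c"
  using Lambda_l_left[of "S (S (S c))"] Lambda_l_right[of c] by (simp add: l_cyclic[of _ "S c"])

lemma S_g_S4: "S g * S (S (S (S c))) = c * S g"
proof -
  have "S g * S (S (S (S c))) = S g * (S (S (S (S c))) * g) * S g" by (simp add: mult.assoc S_g)
  also have "\<dots> = (S g * g) * c * S g" unfolding S4_conjugation by (simp add: mult.assoc)
  finally show ?thesis by (simp add: S_g)
qed

section \<open>The commutator with the integral\<close>

text \<open>
  In the commutator with \<Lambda> the factor S(a2) stands between two factors coming from \<Lambda>; this map is their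
  effect on it.
\<close>

definition central_trace :: "'a \<Rightarrow> 'a" where
  "central_trace y = sw \<Lambda> (\<lambda>p q. S (S p) * y * Si q * S g)"

lemma lin_central_trace: "lin H (smult H) f \<Longrightarrow> lin H (smult H) (\<lambda>x. central_trace (f x))"
  unfolding central_trace_def by (simp add: unimodular_lins)

text \<open>
  The factor x moves from the first leg of \<Lambda> to the second, where it appears as S'(h) with
  x = S^3(h), and passes g^-1 by Radford's formula.
\<close>

lemma central_trace_central: "x * central_trace y = central_trace y * x"
proof -
  define h where "h = Si (Si (Si x))"
  have x: "x = S (S (S h))" by (simp add: h_def)
  have "x * central_trace y = sw \<Lambda> (\<lambda>p q. S (S (S h * p)) * y * Si q * S g)"
    by (simp add: central_trace_def mult_tlift2 x S_mult mult.assoc)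
  also have "\<dots> = sw \<Lambda> (\<lambda>p q. S (S p) * y * Si (h * q) * S g)"
    by (rule left_integral_shift[OF Lambda_left, where s = "smult H" and
        f = "\<lambda>p q. S (S p) * y * Si q * S g"])
       (simp add: unimodular_lins)
  also have "\<dots> = sw \<Lambda> (\<lambda>p q. S (S p) * y * Si q * S g * x)"
    using S_g_S4[of "Si h"] by (simp add: Si_mult x mult.assoc)
  finally show ?thesis by (simp add: central_trace_def tlift2_mult)
qed

lemma central_trace_cyclic: "central_trace (y * z) = central_trace (S (S z) * y)"
proof -
  have "central_trace (y * z) = sw \<Lambda> (\<lambda>p q. S (S p) * y * Si (q * S z) * S g)"
    by (simp add: central_trace_def Si_mult mult.assoc)
  also have "\<dots> = sw \<Lambda> (\<lambda>p q. S (S (p * z)) * y * Si q * S g)"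
    by (rule right_integral_shift[OF Lambda_right, symmetric, where s = "smult H" and
        f = "\<lambda>p q. S (S p) * y * Si q * S g"])
       (simp add: unimodular_lins)
  finally show ?thesis by (simp add: central_trace_def S_mult mult.assoc)
qed

lemma commutator_eq_central_trace: "commutator H a \<Lambda> = sw a (\<lambda>p q. p * central_trace (S q))"
  unfolding commutator_def distinguished_grouplike_eq ring_inverse_eq[OF S_g(2,1)]
  by (simp add: central_trace_def mult_tlift2 mult.assoc)

text \<open>
  Write k a1 \<otimes> a2 = k1 a1 \<otimes> S'(k3) k2 a2 and commute \<Delta>(a) with the coproduct of k.
\<close>

lemma central_slide:
  assumes a: "\<forall>x. a * x = x * a" and f: "bil H s f"
  shows "sw a (\<lambda>p q. f (k * p) q) = sw k (\<lambda>r t. sw r (\<lambda>u v. sw a (\<lambda>p q. f (p * u) (Si t * q * v))))"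
proof -
  note f_lin = bil1[OF f] bil2[OF f]
  have fs: "f x (c \<cdot> y) = s c (f x y)" for c x y
    using f unfolding bil_def Vector_Spaces.linear_iff by blast
  have Si_anti: "sw t (\<lambda>u v. f y (Si v * u * q)) = s (\<epsilon> t) (f y q)" for t y q
  proof -
    have "Si (S (sw t (\<lambda>u v. Si v * u))) = Si (sw t (\<lambda>u v. S u * v))"
      by (simp only: linear_tlift2[OF antipode_linear] S_mult S_Si)
    also have "\<dots> = Si (\<epsilon> t \<cdot> 1)" by (simp only: antipode_left)
    also have "\<dots> = \<epsilon> t \<cdot> 1"
      using Si_linear Si_S[of 1] by (simp add: Vector_Spaces.linear_iff S_one)
    finally have eq: "sw t (\<lambda>u v. Si v * u) = \<epsilon> t \<cdot> 1" by simp
    have "sw t (\<lambda>u v. f y (Si v * u * q)) = f y (sw t (\<lambda>u v. Si v * u) * q)"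
      by (simp add: linear_tlift2[OF bil2[OF f lin_mult_const]])
    then show ?thesis by (simp add: eq smult_mult_left fs)
  qed
  have "sw k (\<lambda>r t. sw r (\<lambda>u v. sw a (\<lambda>p q. f (p * u) (Si t * q * v))))
      = sw k (\<lambda>r t. sw (a * r) (\<lambda>p q. f p (Si t * q)))"
    by (rule tlift2_cong, subst sw_mult[where s = s], simp add: unimodular_lins f_lin,
      subst tlift2_commute, simp add: mult.assoc)
  also have "\<dots> = sw k (\<lambda>r t. sw (r * a) (\<lambda>p q. f p (Si t * q)))"
    using a by simp
  also have "\<dots> = sw k (\<lambda>r t. sw r (\<lambda>u v. sw a (\<lambda>p q. f (u * p) (Si t * v * q))))"
    by (rule tlift2_cong, subst sw_mult[where s = s], simp add: unimodular_lins f_lin,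
      simp add: mult.assoc)
  also have "\<dots> = sw k (\<lambda>r t. sw t (\<lambda>u v. sw a (\<lambda>p q. f (r * p) (Si v * u * q))))"
    by (rule sw_coassoc[where s = s]) (simp add: unimodular_lins f_lin)
  also have "\<dots> = sw k (\<lambda>r t. sw a (\<lambda>p q. s (\<epsilon> t) (f (r * p) q)))"
    by (rule tlift2_cong, subst tlift2_commute, simp add: Si_anti)
  also have "\<dots> = sw a (\<lambda>p q. sw k (\<lambda>r t. s (\<epsilon> t) (f (r * p) q)))"
    by (rule tlift2_commute)
  also have "\<dots> = sw a (\<lambda>p q. f (k * p) q)"
    by (rule tlift2_cong, rule sw_counit_right) (simp add: unimodular_lins f_lin)
  finally show ?thesis ..
qed

text \<open>
  After the slide, cyclicity of the central trace brings the two new factors together as k2 S(k3), which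
  the antipode contracts.
\<close>

lemma commutator_central:
  assumes a: "\<forall>x. a * x = x * a"
  shows "k * commutator H a \<Lambda> = commutator H a \<Lambda> * k"
proof -
  note clins = unimodular_lins lin_central_trace
  have "k * commutator H a \<Lambda> = sw a (\<lambda>p q. k * p * central_trace (S q))"
    by (simp add: commutator_eq_central_trace mult_tlift2 mult.assoc)
  also have "\<dots> = sw k (\<lambda>r t. sw r (\<lambda>u v. sw a (\<lambda>p q. p * u * central_trace (S (Si t * q * v)))))"
    by (rule central_slide[OF a, where s = "smult H" and
        f = "\<lambda>x y. x * central_trace (S y)"])
       (simp add: clins)
  also have "\<dots> = sw k (\<lambda>r t. sw r (\<lambda>u v. sw a (\<lambda>p q. p * u * central_trace (S (q * (v * S t))))))"
  proof (intro tlift2_cong)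
    fix r t u v p q
    show "p * u * central_trace (S (Si t * q * v)) = p * u * central_trace (S (q * (v * S t)))"
      using central_trace_cyclic[of "S (q * v)" t] by (simp add: S_mult mult.assoc)
  qed
  also have "\<dots> = sw k (\<lambda>r t. sw t (\<lambda>u v. sw a (\<lambda>p q. p * r * central_trace (S (q * (u * S v))))))"
    by (rule sw_coassoc[where s = "smult H"])
       (simp add: clins)
  also have "\<dots> = sw k (\<lambda>r t. \<epsilon> t \<cdot> (sw a (\<lambda>p q. p * r * central_trace (S (q * 1)))))"
    by (rule tlift2_cong, rule sw_antipode_right) (simp add: clins)
  also have "\<dots> = sw a (\<lambda>p q. p * k * central_trace (S q))"
    by (subst sw_counit_right) (simp_all add: clins)
  also have "\<dots> = commutator H a \<Lambda> * k"
    by (simp add: commutator_eq_central_trace tlift2_mult mult.assoc central_trace_central)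
  finally show ?thesis .
qed

end

section \<open>Multiplication operators on trilinear maps\<close>

text \<open>
  A tensor of rank three acts on trilinear maps f by f(x, y, z) to f(x t1, y t2, z t3), and
  multiplication of tensors becomes composition of operators, associative without further proof.
  The four operators below belong to t \<otimes> 1, 1 \<otimes> t, and the images of t under \<Delta> \<otimes> id and id \<otimes> \<Delta>.
\<close>

context pointed_coalgebra
begin

lemma tens2_bil: "bil H tscale (tens2 H)"
  unfolding bil_def tens2_def pure_tensor_def Vector_Spaces.linear_iff
  by (auto simp: vector_space_smult vector_space_tscale tscale_def bilin_def
      Vector_Spaces.linear_iff fun_eq_iff)

lemma tens3_tril: "tril H tscale (tens3 H)"
  unfolding tril_def tens3_def pure_tensor_def Vector_Spaces.linear_iff
  by (auto simp: vector_space_smult vector_space_tscale tscale_def trilin_def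
      Vector_Spaces.linear_iff fun_eq_iff)

lemma tlift2_self: "t \<in> tensors2 H \<Longrightarrow> tlift2 H (tens2 H) t = t"
proof -
  assume "t \<in> tensors2 H"
  then obtain xs where t: "t = (\<Sum>(x, y)\<leftarrow>xs. tens2 H x y)"
    unfolding tensors2_def tensors_def tens2_def by (auto simp: case_prod_unfold)
  show ?thesis unfolding t by (rule tlift2_tens2_sum) (use tens2_bil in \<open>simp add: bil_bilin\<close>)
qed

definition mult12 where
  "mult12 t f = (\<lambda>x y z. tlift2 H (\<lambda>a b. f (x * a) (y * b) z) t)"

definition mult23 where
  "mult23 t f = (\<lambda>x y z. tlift2 H (\<lambda>a b. f x (y * a) (z * b)) t)"

definition cop12 where
  "cop12 t f = (\<lambda>x y z. tlift2 H (\<lambda>a b. sw a (\<lambda>u v. f (x * u) (y * v) (z * b))) t)"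

definition cop23 where
  "cop23 t f = (\<lambda>x y z. tlift2 H (\<lambda>a b. sw b (\<lambda>u v. f (x * a) (y * u) (z * v))) t)"

lemma
  assumes f: "tril H s f"
  shows tril_mult12: "tril H s (mult12 t f)" and tril_mult23: "tril H s (mult23 t f)"
    and tril_cop12: "tril H s (cop12 t f)" and tril_cop23: "tril H s (cop23 t f)"
  using tril1[OF f] tril2[OF f] tril3[OF f]
  by (simp_all add: mult12_def mult23_def cop12_def cop23_def lins)

lemma
  assumes f: "tril H s f"
  shows mult12_mult: "mult12 (tmult2 H t u) f = mult12 t (mult12 u f)"
    and mult23_mult: "mult23 (tmult2 H t u) f = mult23 t (mult23 u f)"
    and mult12_one: "mult12 (tens2 H 1 1) f = f" and mult23_one: "mult23 (tens2 H 1 1) f = f"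
    and cop12_one: "cop12 (tens2 H 1 1) f = f" and cop23_one: "cop23 (tens2 H 1 1) f = f"
  using tril1[OF f] tril2[OF f] tril3[OF f]
  by (simp_all add: mult12_def mult23_def cop12_def cop23_def lins fun_eq_iff mult.assoc
     tmult2_lift[where s = s] tlift2_tens2[where s = s] sw_one[where s = s])

lemma cop12_eq_cop23:
  assumes f: "tril H s f"
  shows "cop12 (comult H a) f = cop23 (comult H a) f"
  unfolding cop12_def cop23_def
  by (intro ext, rule sw_coassoc[where s = s])
     (use tril1[OF f] tril2[OF f] tril3[OF f] in \<open>simp add: lins\<close>)

end

context hopf_algebra
begin

lemma
  assumes f: "tril H s f"
  shows cop12_mult: "cop12 (tmult2 H t u) f = cop12 t (cop12 u f)"
    and cop23_mult: "cop23 (tmult2 H t u) f = cop23 t (cop23 u f)"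
proof -
  note f_lin = tril1[OF f] tril2[OF f] tril3[OF f]
  show "cop12 (tmult2 H t u) f = cop12 t (cop12 u f)"
    unfolding cop12_def
    by (intro ext, simp add: tmult2_lift[where s = s] sw_mult[where s = s] hopf_lins f_lin mult.assoc,
        rule tlift2_cong, rule tlift2_commute)
  show "cop23 (tmult2 H t u) f = cop23 t (cop23 u f)"
    unfolding cop23_def
    by (intro ext, simp add: tmult2_lift[where s = s] sw_mult[where s = s] hopf_lins f_lin mult.assoc,
        rule tlift2_cong, rule tlift2_commute)
qed

end

section \<open>The inverse of a twist\<close>

locale twisted_hopf = unimodular_hopf H \<Lambda> l for H :: "('k::field, 'a::ring_1) hopf" and \<Lambda> l +
  fixes J :: "('k, 'a \<times> 'a) tensor"
  assumes twist: "normalized_twist H J"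
begin

abbreviation K where "K \<equiv> tinverse2 H J"
abbreviation Q where "Q \<equiv> twist_Q H J"
definition Qi where "Qi = tlift2 H (\<lambda>x y. x * S y) K"

lemma tinverse2_unique:
  assumes A: "is_tinverse2 H J A" and B: "is_tinverse2 H J B"
  shows "A = B"
proof -
  note b = bil1[OF tens2_bil] bil2[OF tens2_bil]
  have "A = tlift2 H (\<lambda>a b. tens2 H (a * 1) (b * 1)) A"
    using A tlift2_self[of A] by (simp add: is_tinverse2_def)
  also have "\<dots> = tlift2 H (\<lambda>a b. tlift2 H (\<lambda>x y. tens2 H (a * x) (b * y)) (tmult2 H J B)) A"
    using B by (subst tlift2_tens2[of H tscale, symmetric]) (simp_all add: is_tinverse2_def hopf_lins b)
  also have "\<dots> = tlift2 H (\<lambda>a b. tlift2 H (\<lambda>j j'.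
      tlift2 H (\<lambda>x y. tens2 H (a * j * x) (b * j' * y)) B) J) A"
    by (simp add: tmult2_lift[where s = tscale] hopf_lins b mult.assoc)
  also have "\<dots> = tlift2 H (\<lambda>c d. tlift2 H (\<lambda>x y. tens2 H (c * x) (d * y)) B) (tmult2 H A J)"
    by (subst tmult2_lift[where s = tscale]) (simp_all add: hopf_lins b)
  also have "\<dots> = tlift2 H (\<lambda>x y. tens2 H (1 * x) (1 * y)) B"
    using A by (simp add: is_tinverse2_def, subst tlift2_tens2[of H tscale]) (simp_all add: hopf_lins b)
  also have "\<dots> = B" using B tlift2_self[of B] by (simp add: is_tinverse2_def)
  finally show ?thesis .
qed

lemma K_inverse: "is_tinverse2 H J K"
proof -
  obtain A where A: "is_tinverse2 H J A" using twist by (auto simp: normalized_twist_def)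
  have "K = A" unfolding tinverse2_def using A tinverse2_unique by (intro the_equality) auto
  with A show ?thesis by simp
qed

lemma JK: "tmult2 H J K = tens2 H 1 1" and KJ: "tmult2 H K J = tens2 H 1 1"
  using K_inverse by (auto simp: is_tinverse2_def)

lemma JK_lift: "bil H s f \<Longrightarrow> tlift2 H (\<lambda>a b. tlift2 H (\<lambda>c d. f (a * c) (b * d)) K) J = f 1 1"
  and KJ_lift: "bil H s f \<Longrightarrow> tlift2 H (\<lambda>a b. tlift2 H (\<lambda>c d. f (a * c) (b * d)) J) K = f 1 1"
  using tmult2_lift[of s f J K] tmult2_lift[of s f K J]
  by (simp_all add: JK KJ tlift2_tens2)

lemma
  assumes f: "tril H s f"
  shows mult12_JK: "mult12 J (mult12 K f) = f" and mult12_KJ: "mult12 K (mult12 J f) = f"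
    and mult23_JK: "mult23 J (mult23 K f) = f" and mult23_KJ: "mult23 K (mult23 J f) = f"
    and cop12_JK: "cop12 J (cop12 K f) = f" and cop12_KJ: "cop12 K (cop12 J f) = f"
    and cop23_JK: "cop23 J (cop23 K f) = f" and cop23_KJ: "cop23 K (cop23 J f) = f"
  using mult12_mult[OF f] mult23_mult[OF f] cop12_mult[OF f] cop23_mult[OF f]
    mult12_one[OF f] mult23_one[OF f] cop12_one[OF f] cop23_one[OF f] JK KJ
  by metis+

lemma twist_ops:
  assumes f: "tril H s f"
  shows "cop12 J (mult12 J f) = cop23 J (mult23 J f)"
proof (intro ext)
  fix x y z
  define F where "F a b c = f (x * a) (y * b) (z * c)" for a b c
  note f_lin = tril1[OF f] tril2[OF f] tril3[OF f]
  have F: "tril H s F" unfolding F_def by (simp add: hopf_lins f_lin)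
  note F_lin = tril1[OF F] tril2[OF F] tril3[OF F]
  have tmult3_lift: "tlift3 H F (tmult3 H t u) =
      tlift3 H (\<lambda>a b c. tlift3 H (\<lambda>d e e'. F (a * d) (b * e) (c * e')) u) t" for t u
    unfolding tmult3_def by (simp add: tlift3_tlift3[OF F] tlift3_in_tensors3 tlift3_tens3[OF F])
  have "tlift3 H F (tmult3 H (comult_id H J) (tlift2 H (\<lambda>x y. tens3 H x y 1) J))
      = tlift3 H F (tmult3 H (id_comult H J) (tlift2 H (\<lambda>x y. tens3 H 1 x y) J))"
    using twist by (simp add: normalized_twist_def)
  then show "cop12 J (mult12 J f) x y z = cop23 J (mult23 J f) x y z"
    unfolding tmult3_lift comult_id_def id_comult_def
    by (simp add: tlift3_tlift2[of H s] tlift3_tens3[of H s] tlift2_in_tensors3 hopf_lins F_lin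
        cop12_def mult12_def cop23_def mult23_def F_def f_lin mult.assoc)
qed

text \<open>
  The twist equation, multiplied by the inverse of (\<Delta> \<otimes> id)(J) on the left and by 1 \<otimes> K on the right:
  (J \<otimes> 1)(1 \<otimes> K) = (\<Delta> \<otimes> id)(K) (id \<otimes> \<Delta>)(J).
\<close>

lemma twist_ops_mixed:
  assumes f: "tril H s f"
  shows "mult12 J (mult23 K f) = cop12 K (cop23 J f)"
proof -
  note t = tril_mult12 tril_mult23 tril_cop12 tril_cop23 f
  have "mult12 J (mult23 K f) = cop12 K (cop12 J (mult12 J (mult23 K f)))"
    by (simp add: cop12_KJ[of s] t)
  also have "\<dots> = cop12 K (cop23 J (mult23 J (mult23 K f)))" by (simp add: twist_ops[of s] t)
  finally show ?thesis by (simp add: mult23_JK[of s] t)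
qed

text \<open>
  The twist equation with both sides inverted: the operators inverse to its two sides agree.  This
  form is needed for the factors K in the coassociativity of the twisted coproduct.
\<close>

lemma inverse_twist_ops:
  assumes f: "tril H s f"
  shows "mult12 K (cop12 K f) = mult23 K (cop23 K f)"
proof -
  note t = tril_mult12 tril_mult23 tril_cop12 tril_cop23 f
  have "mult12 K (cop12 K f) = mult12 K (cop12 K (cop23 J (mult23 J (mult23 K (cop23 K f)))))"
    by (simp add: mult23_JK[of s] cop23_JK[of s] t)
  also have "\<dots> = mult12 K (cop12 K (cop12 J (mult12 J (mult23 K (cop23 K f)))))"
    by (simp add: twist_ops[of s] t)
  finally show ?thesis by (simp add: cop12_KJ[of s] mult12_KJ[of s] t)
qed

lemma J_counit_left: "lin H s f \<Longrightarrow> tlift2 H (\<lambda>a b. s (\<epsilon> a) (f b)) J = f 1"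
  and J_counit_right: "lin H s f \<Longrightarrow> tlift2 H (\<lambda>a b. s (\<epsilon> b) (f a)) J = f 1"
proof -
  assume f: "lin H s f"
  have "counit_id H J = 1" "id_counit H J = 1" using twist by (auto simp: normalized_twist_def)
  from arg_cong[OF this(1), of f] arg_cong[OF this(2), of f]
  show "tlift2 H (\<lambda>a b. s (\<epsilon> a) (f b)) J = f 1" "tlift2 H (\<lambda>a b. s (\<epsilon> b) (f a)) J = f 1"
    unfolding counit_id_def id_counit_def using f
    by (simp_all add: linear_tlift2[OF f] Vector_Spaces.linear_iff)
qed

lemma K_counit_left:
  assumes f: "lin H (smult H) f"
  shows "tlift2 H (\<lambda>a b. \<epsilon> a \<cdot> f b) K = f 1"
proof -
  have c: "\<epsilon> (a * b) = \<epsilon> a * \<epsilon> b" for a b by (rule counit_mult)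
  define k where "k = tlift2 H (\<lambda>a b. \<epsilon> a \<cdot> b) K"
  have "1 = tlift2 H (\<lambda>a b. tlift2 H (\<lambda>c d. \<epsilon> (a * c) \<cdot> (b * d)) K) J"
    by (subst JK_lift[where s = "smult H"]) (simp_all add: hopf_lins counit_one)
  also have "\<dots> = tlift2 H (\<lambda>a b. \<epsilon> a \<cdot> (b * k)) J"
    unfolding k_def by (simp add: c mult_tlift2 tlift2_smult smult_mult_right)
  also have "\<dots> = k"
    by (subst J_counit_left) (simp_all add: hopf_lins)
  finally have "f 1 = f (tlift2 H (\<lambda>a b. \<epsilon> a \<cdot> b) K)" by (simp add: k_def)
  then show ?thesis using f by (simp add: linear_tlift2[OF f] Vector_Spaces.linear_iff)
qed

text \<open>
  Map the third leg in \<open>twist_ops_mixed\<close> by S and multiply it to the second.  On the right-hand side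
  the coproduct of J2 contracts, and since J is normalized, J (1 \<otimes> Q^-1) = \<Delta>(K1) (1 \<otimes> S(K2)) remains.
\<close>

lemma J_Qi:
  assumes h: "bil H s h"
  shows "tlift2 H (\<lambda>a b. h a (b * Qi)) J = tlift2 H (\<lambda>a b. sw a (\<lambda>u v. h u (v * S b))) K"
proof -
  note h_lin = bil1[OF h] bil2[OF h]
  define f where "f x y z = h x (y * S z)" for x y z
  have f: "tril H s f" unfolding f_def by (simp add: hopf_lins h_lin)
  have eq: "mult12 J (mult23 K f) 1 1 1 = cop12 K (cop23 J f) 1 1 1" by (simp add: twist_ops_mixed[OF f])
  have "tlift2 H (\<lambda>a b. h a (b * Qi)) J = mult12 J (mult23 K f) 1 1 1"
    unfolding mult12_def mult23_def f_def Qi_def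
    by (simp add: mult_tlift2 linear_tlift2[OF bil2[OF h lin_id]] mult.assoc)
  also have "\<dots> = tlift2 H (\<lambda>a b. sw a (\<lambda>u v.
      tlift2 H (\<lambda>c d. sw d (\<lambda>r t. h (u * c) (v * (r * S t) * S b))) J)) K"
    unfolding eq by (simp add: cop12_def cop23_def f_def S_mult S_one mult.assoc)
  also have "\<dots> = tlift2 H (\<lambda>a b. sw a (\<lambda>u v.
      tlift2 H (\<lambda>c d. s (\<epsilon> d) (h (u * c) (v * 1 * S b))) J)) K"
    by (intro tlift2_cong sw_antipode_right) (simp add: hopf_lins h_lin)
  also have "\<dots> = tlift2 H (\<lambda>a b. sw a (\<lambda>u v. h (u * 1) (v * 1 * S b))) K"
    by (intro tlift2_cong J_counit_right) (simp add: hopf_lins h_lin)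
  finally show ?thesis by simp
qed

lemma Q_Qi: "Q * Qi = 1"
proof -
  have "Q * Qi = tlift2 H (\<lambda>a b. S a * (b * Qi)) J"
    by (simp add: twist_Q_def tlift2_mult mult.assoc)
  also have "\<dots> = tlift2 H (\<lambda>a b. sw a (\<lambda>u v. S u * (v * S b))) K"
    by (rule J_Qi[where s = "smult H"]) (simp add: hopf_lins)
  also have "\<dots> = tlift2 H (\<lambda>a b. \<epsilon> a \<cdot> S b) K"
    by (simp add: mult.assoc[symmetric] tlift2_mult[symmetric] antipode_left smult_mult_left)
  also have "\<dots> = 1" by (subst K_counit_left) (simp_all add: hopf_lins S_one)
  finally show ?thesis .
qed

text \<open>
  A right inverse in an algebra of finite dimension is two-sided.
\<close>

lemma Qi_Q: "Qi * Q = 1"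
proof -
  have "inj (\<lambda>z. Qi * z)"
    by (rule inj_on_inverseI[where g = "\<lambda>z. Q * z"]) (simp add: mult.assoc[symmetric] Q_Qi)
  then have "surj (\<lambda>z. Qi * z)" by (intro inj_imp_surj) (simp add: hopf_lins)
  from surjD[OF this, of 1] obtain w where w: "1 = Qi * w" by blast
  have "Q = Q * (Qi * w)" using w by simp
  also have "\<dots> = w" by (simp add: mult.assoc[symmetric] Q_Qi)
  finally show ?thesis using w by simp
qed

lemma inverse_Q: "ring_inverse Q = Qi"
  by (rule ring_inverse_eq[OF Q_Qi Qi_Q])

section \<open>The twisted coproduct and its integrals\<close>

abbreviation T where "T \<equiv> twisted H J"

lemma T_simps [simp]: "smult T = smult H"
  "comult T a = tmult2 H (tmult2 H K (comult H a)) J" "antipode T a = Qi * S a * Q"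
  by (simp_all add: twisted_def inverse_Q)

lemma T_tensors [simp]:
  "tlift2 T = tlift2 H" "tlift3 T = tlift3 H" "tens2 T = tens2 H" "tens3 T = tens3 H"
  "tensors2 T = tensors2 H"
  by (simp_all add: tlift2_def tlift3_def tens2_def tens3_def tensors2_def fun_eq_iff)

lemma sw_T:
  assumes f: "bil H s f"
  shows "tlift2 H f (comult T a) =
    tlift2 H (\<lambda>k k'. sw a (\<lambda>p q. tlift2 H (\<lambda>j j'. f (k * p * j) (k' * q * j')) J)) K"
  using bil1[OF f] bil2[OF f]
  by (simp add: tmult2_lift[where s = s] hopf_lins f)

text \<open>
  On trilinear maps, the two sides are the operators of
  (K \<otimes> 1)(\<Delta> \<otimes> id)(K \<Delta>(a) J)(J \<otimes> 1) and (1 \<otimes> K)(id \<otimes> \<Delta>)(K \<Delta>(a) J)(1 \<otimes> J).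
  The twist equation, its inverse and coassociativity of \<Delta> match them factor by factor.
\<close>

lemma T_coassoc:
  assumes f: "tril H s f"
  shows "tlift2 H (\<lambda>x y. tlift2 H (\<lambda>u v. f u v y) (comult T x)) (comult T a)
    = tlift2 H (\<lambda>x y. tlift2 H (\<lambda>u v. f x u v) (comult T y)) (comult T a)"
proof -
  note f_lin = tril1[OF f] tril2[OF f] tril3[OF f]
  note t = tril_mult12 tril_mult23 tril_cop12 tril_cop23 f
  have "tlift2 H (\<lambda>x y. tlift2 H (\<lambda>u v. f u v y) (comult T x)) (comult T a)
      = tlift2 H (\<lambda>x y.
          tlift2 H (\<lambda>k k'. sw x (\<lambda>p q. tlift2 H (\<lambda>j j'. f (k * p * j) (k' * q * j') y) J)) K) (comult T a)"
    by (rule tlift2_cong, rule sw_T[where s = s]) (simp add: hopf_lins f_lin)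
  also have "\<dots> = mult12 K (cop12 (comult T a) (mult12 J f)) 1 1 1"
    unfolding mult12_def cop12_def by (subst tlift2_commute) simp
  also have "\<dots> = mult12 K (cop12 K (cop12 (comult H a) (cop12 J (mult12 J f)))) 1 1 1"
    by (simp add: cop12_mult[of s] t)
  also have "\<dots> = mult23 K (cop23 K (cop23 (comult H a) (cop23 J (mult23 J f)))) 1 1 1"
    by (simp add: cop12_eq_cop23[of s] twist_ops[of s] inverse_twist_ops[of s] t)
  also have "\<dots> = mult23 K (cop23 (comult T a) (mult23 J f)) 1 1 1"
    by (simp add: cop23_mult[of s] t)
  also have "\<dots> = tlift2 H (\<lambda>x y.
          tlift2 H (\<lambda>k k'. sw y (\<lambda>p q. tlift2 H (\<lambda>j j'. f x (k * p * j) (k' * q * j')) J)) K) (comult T a)"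
    unfolding mult23_def cop23_def by (subst tlift2_commute) simp
  also have "\<dots> = tlift2 H (\<lambda>x y. tlift2 H (\<lambda>u v. f x u v) (comult T y)) (comult T a)"
    by (rule tlift2_cong, rule sw_T[where s = s, symmetric]) (simp add: hopf_lins f_lin)
  finally show ?thesis .
qed

lemma T_pointed_coalgebra: "pointed_coalgebra T"
proof (intro pointed_coalgebra.intro)
  note b = bil1[OF tens2_bil] bil2[OF tens2_bil]
  show "Vector_Spaces.linear (smult T) tscale (comult T)"
  proof -
    have "lin H tscale (\<lambda>x. tlift2 H (\<lambda>a b.
        tlift2 H (\<lambda>c d. tens2 H (a * c) (b * d)) J) (tmult2 H K (comult H x)))"
      by (rule linear_tlift2_arg, simp_all add: hopf_lins b tmult2_in)
        (simp add: tmult2_def hopf_lins b)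
    then show ?thesis unfolding T_simps by (subst tmult2_def) simp
  qed
  show "comult T 1 = tens2 T 1 1"
  proof -
    have "comult T 1 = tlift2 H (tens2 H) (comult T 1)" by (simp add: tlift2_self tmult2_in)
    also have "\<dots> = tens2 H 1 1"
      by (subst sw_T[OF tens2_bil], subst sw_one[where s = tscale], simp add: hopf_lins b)
         (simp add: KJ_lift[OF tens2_bil])
    finally show ?thesis by simp
  qed
  show "comult_id T (comult T x) = id_comult T (comult T x)" for x
    unfolding comult_id_def id_comult_def T_tensors by (rule T_coassoc[OF tens3_tril])
qed (simp_all add: vector_space_smult smult_mult_left smult_mult_right tmult2_in)

text \<open>
  The second leg of K and the first leg of J move through \<Lambda>, which turns K1, K2 into
  K1 S(K2) = Q^-1 and J1, J2 into S(J1) J2 = Q.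
\<close>

lemma sw_T_Lambda:
  assumes f: "bil H s f"
  shows "tlift2 H f (comult T \<Lambda>) = sw \<Lambda> (\<lambda>p q. f (Qi * p) (q * Q))"
proof -
  note f_lin = bil1[OF f] bil2[OF f]
  have "tlift2 H f (comult T \<Lambda>)
      = tlift2 H (\<lambda>k k'. tlift2 H (\<lambda>j j'. sw \<Lambda> (\<lambda>p q. f (k * (p * j)) (k' * q * j'))) J) K"
    by (subst sw_T[OF f], rule tlift2_cong, subst tlift2_commute, simp add: mult.assoc)
  also have "\<dots> = tlift2 H (\<lambda>k k'. tlift2 H (\<lambda>j j'. sw \<Lambda> (\<lambda>p q. f (k * (S k' * p * j)) (q * j'))) J) K"
    by (rule tlift2_cong, rule tlift2_cong, rule left_integral_shift[OF Lambda_left, symmetric,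
        where s = s and f = "\<lambda>p q. f (_ * (p * _)) (q * _)"]) (simp add: hopf_lins f_lin)
  also have "\<dots> = tlift2 H (\<lambda>k k'. tlift2 H (\<lambda>j j'. sw \<Lambda> (\<lambda>p q. f (k * S k' * p) (q * (S j * j')))) J) K"
    using right_integral_shift[OF Lambda_right, where s = s and f = "\<lambda>p q. f (_ * (S _ * p)) (q * _)"]
    by (simp add: hopf_lins f_lin mult.assoc)
  also have "\<dots> = sw \<Lambda> (\<lambda>p q. tlift2 H (\<lambda>k k'. tlift2 H (\<lambda>j j'. f (k * S k' * p) (q * (S j * j'))) J) K)"
    by (subst (2) tlift2_commute, subst tlift2_commute) (rule refl)
  also have "\<dots> = sw \<Lambda> (\<lambda>p q. f (Qi * p) (q * Q))"
    by (simp add: Qi_def twist_Q_def tlift2_mult mult_tlift2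
      linear_tlift2[OF bil1[OF f lin_id]] linear_tlift2[OF bil2[OF f lin_id]],
      rule tlift2_cong, rule tlift2_commute)
  finally show ?thesis .
qed

text \<open>
  With the coproduct Q^-1 \<Lambda>1 \<otimes> \<Lambda>2 Q the normalization reads
  l(S(Q^-1) \<Lambda>1) \<Lambda>2 Q = S'(S(Q^-1)) Q = 1, and nondegeneracy is inherited because Q is invertible.
\<close>

lemma T_frobenius: "frobenius_coalgebra T \<Lambda> (twisted_dual_integral H J l)"
proof (intro frobenius_coalgebra.intro T_pointed_coalgebra frobenius_coalgebra_axioms.intro)
  have l: "twisted_dual_integral H J l = (\<lambda>x. l (S Qi * Q * x))"
    by (simp add: twisted_dual_integral_def inverse_Q fun_eq_iff)
  show "lin T (*) (twisted_dual_integral H J l)" by (simp add: l unimodular_lins)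
  have "sw \<Lambda> (\<lambda>p q. l (S Qi * Q * (Qi * p)) \<cdot> (q * Q)) = Si (S Qi) * Q"
    by (simp add: Lambda_Si[symmetric] tlift2_mult smult_mult_left del: Si_S)
      (simp add: mult.assoc[symmetric] mult.assoc[of _ Q Qi] Q_Qi)
  then show "tlift2 T (\<lambda>p q. smult T (twisted_dual_integral H J l p) q) (comult T \<Lambda>) = 1"
    unfolding T_tensors l
    by (subst sw_T_Lambda[where s = "smult H"]) (simp_all add: unimodular_lins Qi_Q)
  fix f x assume f: "lin T (*) f" and 0: "tlift2 T (\<lambda>p q. smult T (f p) q) (comult T \<Lambda>) = 0"
  have f': "lin H (*) f" using f by simp
  note f_lin = linear_compose_form[OF _ f']
  have "sw \<Lambda> (\<lambda>p q. f (Qi * p) \<cdot> q) * Q = sw \<Lambda> (\<lambda>p q. f (Qi * p) \<cdot> (q * Q))"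
    by (simp add: tlift2_mult smult_mult_left)
  also have "\<dots> = 0" using 0 unfolding T_tensors
    by (subst (asm) sw_T_Lambda[where s = "smult H"]) (simp_all add: unimodular_lins f_lin)
  finally have "sw \<Lambda> (\<lambda>p q. f (Qi * p) \<cdot> q) * Q * Qi = 0" by simp
  then have "sw \<Lambda> (\<lambda>p q. f (Qi * p) \<cdot> q) = 0" by (simp add: mult.assoc Q_Qi)
  from nondegenerate[OF _ this, of "Q * x"] show "f x = 0"
    by (simp add: unimodular_lins f_lin mult.assoc[symmetric] Qi_Q)
qed

text \<open>
  In Q^-1 \<Lambda>1 l(S(Q^-1) Q \<Lambda>2 Q) the last factor Q cycles to the front under l as S^2(Q), and
  \<open>Lambda_l_left\<close> evaluates the result.
\<close>

lemma distinguished_T: "distinguished_grouplike T = Qi * S Q * S (S Qi) * S (S (S Q)) * g"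
proof -
  interpret T: frobenius_coalgebra T \<Lambda> "twisted_dual_integral H J l" by (rule T_frobenius)
  have l: "twisted_dual_integral H J l = (\<lambda>x. l (S Qi * Q * x))"
    by (simp add: twisted_dual_integral_def inverse_Q fun_eq_iff)
  have "distinguished_grouplike T = tlift2 H (\<lambda>p q. l (S Qi * Q * q) \<cdot> p) (comult T \<Lambda>)"
    unfolding T.distinguished_grouplike_eq T.g_def unfolding l T_tensors T_simps(1) ..
  also have "\<dots> = sw \<Lambda> (\<lambda>p q. l (S Qi * Q * (q * Q)) \<cdot> (Qi * p))"
    by (rule sw_T_Lambda[where s = "smult H"])
       (simp add: unimodular_lins)
  also have "\<dots> = sw \<Lambda> (\<lambda>p q. l (S (S Q) * S Qi * Q * q) \<cdot> (Qi * p))"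
    using l_cyclic[of _ Q] by (simp add: mult.assoc[symmetric])
  also have "\<dots> = Qi * S (S (S Q) * S Qi * Q) * g"
    by (simp add: mult.assoc Lambda_l_left[symmetric] mult_tlift2 smult_mult_right)
  finally show ?thesis by (simp add: S_mult mult.assoc)
qed

lemma inverse_distinguished_T:
  "ring_inverse (distinguished_grouplike T) = S g * S (S (S Qi)) * S (S Q) * S Qi * Q"
proof -
  have 1: "S Q * (S Qi * x) = x" "S (S Qi) * (S (S Q) * x) = x"
    "S (S (S Q)) * (S (S (S Qi)) * x) = x" "Qi * (Q * x) = x" "g * (S g * x) = x"
    "S Qi * (S Q * x) = x" "S (S Q) * (S (S Qi) * x) = x"
    "S (S (S Qi)) * (S (S (S Q)) * x) = x" "Q * (Qi * x) = x" "S g * (g * x) = x" for x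
    by (simp_all only: mult.assoc[symmetric] S_mult[symmetric] Q_Qi Qi_Q S_g S_one mult_1_left)
  show ?thesis unfolding distinguished_T
    by (rule ring_inverse_eq) (simp_all add: mult.assoc 1 Q_Qi Qi_Q S_g)
qed

section \<open>Invariance of the commutator under twisting\<close>

lemma inv_antipode_T: "inv (antipode T) y = Si (Q * y * Qi)"
proof (rule inv_f_eq)
  have 1: "Q * (Qi * x) = x" "Qi * (Q * x) = x" for x
    by (simp_all add: mult.assoc[symmetric] Q_Qi Qi_Q)
  show "inj (antipode T)"
  proof (rule inj_on_inverseI)
    show "Si (Q * antipode T x * Qi) = x" for x
      by (simp add: mult.assoc 1 Q_Qi)
  qed
  show "antipode T (Si (Q * y * Qi)) = y"
    by (simp add: mult.assoc 1 Qi_Q)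
qed

text \<open>
  The outer factors form a conjugation of a central element by \<open>w\<close>, and cancel; the factor that the
  coproduct of \<Lambda> contributes in its second leg is cancelled by the inverse of the distinguished
  group-like element (fact \<open>2\<close> in the proof).
\<close>

lemma commutator_T_eq_central_trace:
  "commutator T a \<Lambda> = tlift2 H (\<lambda>x y. x * central_trace (S (y * Qi * S Q))) (comult T a)"
proof -
  have 1: "S Q * (S Qi * x) = x" "S (S Qi) * (S (S Q) * x) = x" "Qi * (Q * x) = x"
    "Q * (Qi * x) = x" for x
    by (simp_all only: mult.assoc[symmetric] S_mult[symmetric] Q_Qi Qi_Q S_one mult_1_left)
  have 2: "Si Q * (S g * (S (S (S Qi)) * x)) = S g * x" for x
  proof -
    have "Si Q * (S g * S (S (S Qi))) = Si (Qi * Q) * S g"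
      using S_g_S4[of "Si Qi"] by (simp add: Si_mult mult.assoc)
    then have "Si Q * (S g * S (S (S Qi))) = S g" using Si_S[of 1] by (simp add: Qi_Q S_one)
    then show ?thesis by (simp add: mult.assoc[symmetric])
  qed
  define w where "w = Qi * S Q * S (S Qi)"
  define w' where "w' = S (S Q) * S Qi * Q"
  have ww': "w * w' = 1" by (simp add: w_def w'_def mult.assoc 1 Qi_Q)
  have inner: "tlift2 H (\<lambda>b1 b2. x * antipode T (antipode T b1) * antipode T y * inv (antipode T) b2
      * ring_inverse (distinguished_grouplike T)) (comult T \<Lambda>)
      = x * central_trace (S (y * Qi * S Q))" for x y
  proof -
    have "tlift2 H (\<lambda>b1 b2. x * antipode T (antipode T b1) * antipode T y * inv (antipode T) b2
      * ring_inverse (distinguished_grouplike T)) (comult T \<Lambda>)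
      = sw \<Lambda> (\<lambda>p q. x * antipode T (antipode T (Qi * p)) * antipode T y * inv (antipode T) (q * Q)
      * ring_inverse (distinguished_grouplike T))"
      unfolding inv_antipode_T by (rule sw_T_Lambda[where s = "smult H"])
       (simp add: unimodular_lins)
    also have "\<dots> = x * (w * central_trace (S Qi * S y * Q) * w')"
      unfolding inv_antipode_T inverse_distinguished_T
      by (simp add: central_trace_def mult_tlift2 tlift2_mult S_mult Si_mult
          w_def w'_def mult.assoc 1 2 Q_Qi)
    also have "\<dots> = x * (central_trace (S Qi * S y * Q) * (w * w'))"
      using central_trace_central[of w] by (simp add: mult.assoc)
    also have "\<dots> = x * central_trace (S (y * Qi * S Q))"
      using central_trace_cyclic[of "S Qi * S y" Q] by (simp add: ww' S_mult mult.assoc)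
    finally show ?thesis .
  qed
  show ?thesis unfolding commutator_def T_tensors inner ..
qed

text \<open>
  Let k \<otimes> k' and c \<otimes> c' be two copies of the inverse twist.  By \<open>J_Qi\<close>, the arguments of h are the legs of
  k1 c1 \<otimes> k2 c2 S(k3 S(k') Q c').  This is x1 \<otimes> x2 S(y) for
  x \<otimes> y = k1 c \<otimes> k2 S(k') Q c', and a second use of \<open>J_Qi\<close>, backwards, gives
  x \<otimes> y = J (1 \<otimes> Q^-1 Q) K = 1 \<otimes> 1.
\<close>

lemma twist_slide:
  assumes h: "bil H s h"
  shows "tlift2 H (\<lambda>k k'. sw k (\<lambda>r t. sw r (\<lambda>u v. tlift2 H (\<lambda>j j'.
    h (u * j) (v * (j' * Qi) * (S Q * S (t * S k')))) J))) K = h 1 1"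
proof -
  note h_lin = bil1[OF h] bil2[OF h]
  define G where "G x y = sw x (\<lambda>m n. h m (n * S y))" for x y
  have G: "bil H s G" unfolding G_def by (simp add: hopf_lins h_lin)
  note G_lin = bil1[OF G] bil2[OF G]
  have "tlift2 H (\<lambda>k k'. sw k (\<lambda>r t. sw r (\<lambda>u v. tlift2 H (\<lambda>j j'.
      h (u * j) (v * (j' * Qi) * (S Q * S (t * S k')))) J))) K
    = tlift2 H (\<lambda>k k'. sw k (\<lambda>r t. sw r (\<lambda>u v.
      tlift2 H (\<lambda>c d. sw c (\<lambda>e e'.
      h (u * e) (v * (e' * S d) * (S Q * S (t * S k'))))) K))) K"
    by (intro tlift2_cong, rule J_Qi[where s = s and h = "\<lambda>x y. h (_ * x) (_ * y * _)"])
      (simp add: hopf_lins h_lin)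
  also have "\<dots> = tlift2 H (\<lambda>k k'. sw k (\<lambda>r t. tlift2 H (\<lambda>c d. sw r (\<lambda>u v. sw c (\<lambda>e e'.
      h (u * e) (v * e' * S (t * S k' * Q * d))))) K)) K"
    by (rule tlift2_cong, rule tlift2_cong, subst tlift2_commute) (simp add: S_mult mult.assoc)
  also have "\<dots> = tlift2 H (\<lambda>k k'. sw k (\<lambda>r t. tlift2 H (\<lambda>c d. G (r * c) (t * S k' * Q * d)) K)) K"
    unfolding G_def by (subst sw_mult[where s = s]) (simp_all add: hopf_lins h_lin)
  also have "\<dots> = tlift2 H (\<lambda>j j'. tlift2 H (\<lambda>c d. G (j * c) (j' * Qi * Q * d)) K) J"
    by (rule J_Qi[symmetric, where s = s and h = "\<lambda>x y. tlift2 H (\<lambda>c d. G (x * c) (y * Q * d)) K"])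
      (simp add: hopf_lins G_lin)
  also have "\<dots> = G 1 1" by (simp add: mult.assoc[of _ Qi Q] Qi_Q JK_lift[OF G])
  also have "\<dots> = h 1 1" unfolding G_def
    by (subst sw_one[where s = s]) (simp_all add: hopf_lins h_lin S_one)
  finally show ?thesis .
qed

lemma commutator_T:
  assumes a: "\<forall>x. a * x = x * a"
  shows "commutator T a \<Lambda> = commutator H a \<Lambda>"
proof -
  note clins = unimodular_lins lin_central_trace
  \<comment> \<open>The two ways in which a factor at the left of the argument of S is carried to its right end.\<close>
  have rot: "central_trace (S (k * y)) = central_trace (S (y * S (S k)))" for k y
    using central_trace_cyclic[of "S y" "S k"] by (simp add: S_mult)
  have rot': "central_trace (S (Si t * y)) = central_trace (S (y * S t))" for t y
    using central_trace_cyclic[of "S y" t] by (simp add: S_mult)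
  have "commutator T a \<Lambda> = tlift2 H (\<lambda>k k'. sw a (\<lambda>p q. tlift2 H (\<lambda>j j'.
      k * p * j * central_trace (S (k' * (q * j' * Qi * S Q)))) J)) K"
    unfolding commutator_T_eq_central_trace
    by (subst sw_T[where s = "smult H"]) (simp_all add: clins mult.assoc)
  also have "\<dots> = tlift2 H (\<lambda>k k'. sw a (\<lambda>p q. tlift2 H (\<lambda>j j'.
      k * p * j * central_trace (S (q * j' * Qi * S Q * S (S k')))) J)) K"
    by (intro tlift2_cong) (subst rot, simp add: mult.assoc)
  also have "\<dots> = tlift2 H (\<lambda>k k'. sw k (\<lambda>r t. sw r (\<lambda>u v. sw a (\<lambda>p q. tlift2 H (\<lambda>j j'.
      p * u * j * central_trace (S (Si t * q * v * j' * Qi * S Q * S (S k')))) J)))) K"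
    by (rule tlift2_cong, rule central_slide[OF a, where s = "smult H" and
        f = "\<lambda>x y. tlift2 H (\<lambda>j j'. x * j * central_trace (S (y * j' * Qi * S Q * S (S _)))) J"])
       (simp add: clins)
  also have "\<dots> = tlift2 H (\<lambda>k k'. sw k (\<lambda>r t. sw r (\<lambda>u v. sw a (\<lambda>p q. tlift2 H (\<lambda>j j'.
      p * (u * j) * central_trace (S (q * (v * (j' * Qi) * (S Q * S (t * S k')))))) J)))) K"
  proof (intro tlift2_cong)
    fix k k' r t u v p q j j'
    show "p * u * j * central_trace (S (Si t * q * v * j' * Qi * S Q * S (S k')))
        = p * (u * j) * central_trace (S (q * (v * (j' * Qi) * (S Q * S (t * S k')))))"
      using rot'[of t "q * v * j' * Qi * S Q * S (S k')"] by (simp add: S_mult mult.assoc)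
  qed
  also have "\<dots> = sw a (\<lambda>p q. tlift2 H (\<lambda>k k'. sw k (\<lambda>r t. sw r (\<lambda>u v. tlift2 H (\<lambda>j j'.
      p * (u * j) * central_trace (S (q * (v * (j' * Qi) * (S Q * S (t * S k')))))) J))) K)"
    unfolding tlift2_commute[where t = "comult H a"] ..
  \<comment> \<open>Everything to the right of \<Delta>(a) is now the tensor of \<open>twist_slide\<close>.\<close>
  also have "\<dots> = sw a (\<lambda>p q. p * 1 * central_trace (S (q * 1)))"
    by (rule tlift2_cong, rule twist_slide[where s = "smult H" and
        h = "\<lambda>x y. _ * x * central_trace (S (_ * y))"])
       (simp add: clins)
  finally show ?thesis by (simp add: commutator_eq_central_trace)
qed

text \<open>
  Written out, S(Q^-1) Q is S^2(K2) S(K1) S(J1) J2.  The first factor cycles to the end under l,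
  passes z, and the legs of J K pair up.
\<close>

lemma twisted_integral_central:
  assumes z: "\<And>x. x * z = z * x"
  shows "twisted_dual_integral H J l z = l z"
proof -
  have "twisted_dual_integral H J l z
      = tlift2 H (\<lambda>k k'. tlift2 H (\<lambda>j j'. l (S (S k') * (S k * S j * j' * z))) J) K"
    unfolding twisted_dual_integral_def inverse_Q unfolding Qi_def twist_Q_def
    by (simp add: linear_tlift2[OF antipode_linear] S_mult tlift2_mult mult_tlift2
        linear_tlift2[OF l_lin] mult.assoc, rule tlift2_commute)
  also have "\<dots> = tlift2 H (\<lambda>k k'. tlift2 H (\<lambda>j j'. l (S (j * k) * (j' * k') * z)) J) K"
  proof (intro tlift2_cong)
    fix k k' j j'
    have "l (S (S k') * (S k * S j * j' * z)) = l (S k * S j * j' * (z * k'))"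
      by (simp only: l_cyclic[symmetric] mult.assoc)
    then show "l (S (S k') * (S k * S j * j' * z)) = l (S (j * k) * (j' * k') * z)"
      by (simp only: z[of k', symmetric] S_mult mult.assoc)
  qed
  also have "\<dots> = tlift2 H (\<lambda>j j'. tlift2 H (\<lambda>k k'. l (S (j * k) * (j' * k') * z)) K) J"
    by (rule tlift2_commute)
  also have "\<dots> = l (S 1 * 1 * z)"
    by (rule JK_lift[where s = "(*)"])
       (simp add: unimodular_lins)
  finally show ?thesis by (simp add: S_one)
qed

end

theorem theorem4p1:
  fixes H :: "('k::field, 'a::ring_1) hopf"
    and \<Lambda> a :: 'a
    and l :: "'a \<Rightarrow> 'k"
    and J :: "('k, 'a \<times> 'a) tensor"
  assumes "hopf_algebra H" and "finite_dim H" and "unimodular H"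
    and "left_integral H \<Lambda>" and "dual_right_integral H l" and "l \<Lambda> = 1"
    and "normalized_twist H J"
    and "\<forall>x. a * x = x * a"
  shows "commutator (twisted H J) a \<Lambda> = commutator H a \<Lambda> \<and>
    twisted_dual_integral H J l (commutator (twisted H J) a \<Lambda>) = l (commutator H a \<Lambda>)"
proof -
  interpret twisted_hopf H \<Lambda> l J
    using assms by (intro twisted_hopf.intro unimodular_hopf.intro unimodular_hopf_axioms.intro
      twisted_hopf_axioms.intro) (auto simp: unimodular_def)
  show ?thesis
    using commutator_T[OF assms(8)] twisted_integral_central[OF commutator_central[OF assms(8)]]
    by simp
qed

end
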